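(* The set $\mathbf{S}=\{A : \mathbf{PH}^A\neq\mathbf{PSPACE}^A\}\subseteq 2^\omega$ is $\boldsymbol{\Pi}^0_2$-hard, i.e., $\mathbf{S}\notin\boldsymbol{\Sigma}^0_2$.
   Context: Binary strings are identified with natural numbers via a fixed effective enumeration of $\{0,1\}^{<\omega}$, so that an oracle is identified with an element of the Cantor space $2^\omega$ (product topology). $\mathbf{PH}^A$ and $\mathbf{PSPACE}^A$ are the relativized polynomial hierarchy and relativized polynomial space. $\boldsymbol{\Sigma}^0_2$ is the class of countable unions of closed subsets of $2^\omega$; $\boldsymbol{\Pi}^0_2$ the class of countable intersections of open sets. *)

theory Defs
  imports "HOL-Analysis.Analysis" "HOL-Computational_Algebra.Polynomial"
begin

section \<open>Binary strings and oracles\<close>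

text \<open>
  The enumeration of binary strings is bijective base-2 notation, least significant digit first,
  with digits 1 (for \<open>False\<close>) and 2 (for \<open>True\<close>). It lists the strings in order of length.
\<close>

fun string_index :: "bool list \<Rightarrow> nat" where
  "string_index [] = 0"
| "string_index (b # w) = 2 * string_index w + (if b then 2 else 1)"

lemma bij_string_index: "bij string_index"
proof (rule bijI)
  show "inj string_index"
  proof (rule injI)
    fix v w
    assume "string_index v = string_index w"
    then show "v = w"
    proof (induction v arbitrary: w)
      case Nil
      then show ?case by (cases w) (auto split: if_splits)
    next
      case (Cons a v)
      then obtain b w' where w: "w = b # w'" by (cases w) (auto split: if_splits)
      have eq: "2 * string_index v + (if a then 2 else 1) = 2 * string_index w' + (if b then 2 else 1)"
        using Cons.prems w by simp
      have "a = b" using eq by (cases a; cases b; simp; presburger)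
      moreover have "string_index v = string_index w'" using eq \<open>a = b\<close> by simp
      ultimately show ?case using Cons.IH w by blast
    qed
  qed
  have "\<exists>w. string_index w = n" for n
  proof (induction n rule: less_induct)
    case (less n)
    show ?case
    proof (cases "n = 0")
      case True
      then show ?thesis by (metis string_index.simps(1))
    next
      case False
      then obtain w where "string_index w = (n - 1) div 2"
        using less.IH[of "(n - 1) div 2"] by fastforce
      then have "string_index (even n # w) = n"
        using False by (auto elim!: evenE oddE)
      then show ?thesis by blast
    qed
  qed
  then show "surj string_index" by (metis surjI)
qed

definition oracle_of :: "(nat \<Rightarrow> bool) \<Rightarrow> bool list set" where
  "oracle_of A = {w. A (string_index w)}"

section \<open>Oracle Turing machines\<close>

text \<open>
  Machines are nondeterministic, with finitely many two-way infinite tapes. Tape 0 initially holds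
  the input, tape 1 is the query tape. Symbol 0 is the blank, symbols 1 and 2 are the
  bits \<open>False\<close> and \<open>True\<close>, larger numbers are auxiliary symbols. Since a program is a finite list of
  instructions, only finitely many states and symbols are ever used.
\<close>

datatype move = Left | Stay | Right

primrec shift :: "move \<Rightarrow> int" where
  "shift Left = -1"
| "shift Stay = 0"
| "shift Right = 1"

datatype instr = Instr
  (source: nat) (scan: "nat list") (target: nat) (print: "nat list") (moves: "move list")

datatype otm = OTM
  (tapes: nat) (start: nat) (accept: nat) (query: nat) (yes: nat) (no: nat) (program: "instr list")

definition wf_otm :: "otm \<Rightarrow> bool" where
  "wf_otm M \<longleftrightarrow> 2 \<le> tapes M \<and> distinct [accept M, query M, yes M, no M] \<and>
     (\<forall>i\<in>set (program M).
        length (scan i) = tapes M \<and> length (print i) = tapes M \<and> length (moves i) = tapes M \<and>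
        source i \<noteq> accept M \<and> source i \<noteq> query M)"

definition deterministic :: "otm \<Rightarrow> bool" where
  "deterministic M \<longleftrightarrow>
     (\<forall>i\<in>set (program M). \<forall>j\<in>set (program M). source i = source j \<and> scan i = scan j \<longrightarrow> i = j)"

datatype config = Config (state: nat) (tape: "nat \<Rightarrow> int \<Rightarrow> nat") (head: "nat \<Rightarrow> int")

definition bit_symbol :: "bool \<Rightarrow> nat" where
  "bit_symbol b = (if b then 2 else 1)"

definition init :: "otm \<Rightarrow> bool list \<Rightarrow> config" where
  "init M x = Config (start M)
     (\<lambda>i p. if i = 0 \<and> 0 \<le> p \<and> nat p < length x then bit_symbol (x ! nat p) else 0)
     (\<lambda>i. 0)"

text \<open>
  The queried string is the maximal block of bits on the query tape starting at cell 0. The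
  \<open>LEAST\<close> exists because only finitely many cells of a tape are nonblank in any reachable
  configuration.
\<close>

definition query_string :: "config \<Rightarrow> bool list" where
  "query_string c =
     map (\<lambda>p. tape c 1 (int p) = bit_symbol True)
       [0..<LEAST n. tape c 1 (int n) \<notin> range bit_symbol]"

definition scanned :: "otm \<Rightarrow> config \<Rightarrow> nat list" where
  "scanned M c = map (\<lambda>i. tape c i (head c i)) [0..<tapes M]"

definition exec :: "otm \<Rightarrow> instr \<Rightarrow> config \<Rightarrow> config" where
  "exec M i c = Config (target i)
     (\<lambda>j. if j < tapes M then (tape c j)(head c j := print i ! j) else tape c j)
     (\<lambda>j. if j < tapes M then head c j + shift (moves i ! j) else head c j)"

inductive step :: "otm \<Rightarrow> bool list set \<Rightarrow> config \<Rightarrow> config \<Rightarrow> bool" for M B where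
  step_instr: "\<lbrakk>i \<in> set (program M); state c \<noteq> query M; source i = state c; scan i = scanned M c\<rbrakk>
    \<Longrightarrow> step M B c (exec M i c)"
| step_query: "state c = query M
    \<Longrightarrow> step M B c (Config (if query_string c \<in> B then yes M else no M) (tape c) (head c))"

definition accepts :: "otm \<Rightarrow> bool list set \<Rightarrow> bool list \<Rightarrow> bool" where
  "accepts M B x \<longleftrightarrow> (\<exists>c. (step M B)\<^sup>*\<^sup>* (init M x) c \<and> state c = accept M)"

text \<open>Every computation path on input \<open>x\<close> halts after at most \<open>t\<close> steps.\<close>

definition time_bounded :: "otm \<Rightarrow> bool list set \<Rightarrow> bool list \<Rightarrow> nat \<Rightarrow> bool" where
  "time_bounded M B x t \<longleftrightarrow> (\<forall>n c. (step M B ^^ n) (init M x) c \<longrightarrow> n \<le> t)"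

text \<open>The query tape is subject to the space bound as well.\<close>

definition space_bounded :: "otm \<Rightarrow> bool list set \<Rightarrow> bool list \<Rightarrow> nat \<Rightarrow> bool" where
  "space_bounded M B x s \<longleftrightarrow>
     (\<forall>c. (step M B)\<^sup>*\<^sup>* (init M x) c \<longrightarrow> (\<forall>i<tapes M. \<bar>head c i\<bar> \<le> int s))"

definition halts :: "otm \<Rightarrow> bool list set \<Rightarrow> bool list \<Rightarrow> bool" where
  "halts M B x \<longleftrightarrow> (\<exists>c. (step M B)\<^sup>*\<^sup>* (init M x) c \<and> (\<nexists>c'. step M B c c'))"

section \<open>Relativized complexity classes\<close>

definition P_class :: "bool list set \<Rightarrow> bool list set set" where
  "P_class B = {L. \<exists>M. wf_otm M \<and> deterministic M \<and>
     (\<exists>p :: nat poly. \<forall>x. time_bounded M B x (poly p (length x))) \<and> L = {x. accepts M B x}}"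

definition NP_class :: "bool list set \<Rightarrow> bool list set set" where
  "NP_class B = {L. \<exists>M. wf_otm M \<and>
     (\<exists>p :: nat poly. \<forall>x. time_bounded M B x (poly p (length x))) \<and> L = {x. accepts M B x}}"

definition PSPACE :: "bool list set \<Rightarrow> bool list set set" where
  "PSPACE B = {L. \<exists>M. wf_otm M \<and> deterministic M \<and> (\<forall>x. halts M B x) \<and>
     (\<exists>p :: nat poly. \<forall>x. space_bounded M B x (poly p (length x))) \<and> L = {x. accepts M B x}}"

primrec Sigma_class :: "nat \<Rightarrow> bool list set \<Rightarrow> bool list set set" where
  "Sigma_class 0 B = P_class B"
| "Sigma_class (Suc k) B = (\<Union>C\<in>Sigma_class k B. NP_class C)"

definition PH :: "bool list set \<Rightarrow> bool list set set" where
  "PH B = (\<Union>k. Sigma_class k B)"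

end

theory Submission
  imports Defs
begin

text \<open>
  Suppose that the set is a countable union of closed sets \<open>F n\<close>. An oracle \<open>A\<close> outside all \<open>F n\<close> that is
  nevertheless in the set is built by finite extensions, alternating between two kinds of requirements.

  \<^item> \<open>A \<notin> F n\<close>: every finite condition extends to an oracle with \<open>PH = PSPACE\<close>, which is not in
    \<open>F n\<close>, and a finite part of it already keeps out of the closed set \<open>F n\<close>. Such an oracle answers, by recursion on
    the length of the question, suitably padded questions about all \<open>PH\<close> and \<open>PSPACE\<close> computations relative to itself.

  \<^item> The language \<open>{x. odd (card {w \<in> A. length w = length x})}\<close>, which is in \<open>PSPACE\<close>, differs from a given
    \<open>PH\<close> language. On inputs of length \<open>n\<close> the latter is a constant-depth circuit of size \<open>2 ^ poly n\<close> in the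
    \<open>2 ^ n\<close> bits of \<open>A\<close> of length \<open>n\<close>. By Razborov and Smolensky such a circuit agrees on most inputs with a polynomial
    of degree \<open>poly n\<close> over the field with three elements, and parity does not.
\<close>

section \<open>Low-degree functions over the field with three elements\<close>

text \<open>The characteristic must not be 2, where parity itself is linear. With three elements
  every nonzero square is 1, so one squaring turns a sum into an exact zero test. The counts fit
  because a fixed number of levels gives a degree polynomial in \<open>n\<close>, hence only
  polylogarithmic in the \<open>2 ^ n\<close> variables, while approximating parity takes a degree
  of the order of the square root of their number.

  A time or space bound is a property of a machine together with an oracle, but the oracle is known
  only at the end of the construction. So the bounds are built into acceptance
  (\<open>clocked\<close>, \<open>spaced\<close>), which leaves countably many operators defined on
  all oracles. Each has a polynomial bound on the length of the strings that matter
  (\<open>local_op\<close>). This bound serves twice: a question padded beyond it depends only on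
  shorter strings, which makes the self-referential oracle well-founded, and a disagreement with
  parity depends on finitely many bits, so a finite condition forces it.\<close>

lemma three_cases: "x = 0 \<or> x = 1 \<or> x = (-1 :: 3)"
proof (cases x)
  case (of_int z)
  then have "z = 0 \<or> z = 1 \<or> z = 2" by auto
  moreover have "(-1 :: 3) = 2" by simp
  ultimately show ?thesis using of_int by auto
qed

text \<open>Inputs are subsets \<open>X\<close> of \<open>V\<close>; the character \<open>chi {v}\<close> is the variable \<open>v\<close> with values \<open>1, -1\<close> instead of
  \<open>0, 1\<close>, and \<open>deg V d\<close> consists of the multilinear polynomials of degree at most \<open>d\<close> in these variables.\<close>

definition chi :: "'v set \<Rightarrow> 'v set \<Rightarrow> 3" where
  "chi S X = (-1) ^ card (S \<inter> X)"

definition deg :: "'v set \<Rightarrow> nat \<Rightarrow> ('v set \<Rightarrow> 3) set" where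
  "deg V d = {f. \<exists>c. \<forall>X. f X = (\<Sum>S | S \<subseteq> V \<and> card S \<le> d. c S * chi S X)}"

lemma chi_empty [simp]: "chi {} X = 1"
  by (simp add: chi_def)

text \<open>Elements of \<open>S \<inter> T\<close> contribute their sign twice, which cancels, so
  characters multiply as sets do under symmetric difference.\<close>

lemma chi_mult:
  assumes "finite S" "finite T"
  shows "chi S X * chi T X = chi ((S - T) \<union> (T - S)) X"
proof -
  have S: "S \<inter> X = ((S - T) \<inter> X) \<union> (S \<inter> T \<inter> X)" by blast
  have T: "T \<inter> X = ((T - S) \<inter> X) \<union> (S \<inter> T \<inter> X)" by blast
  have ST: "((S - T) \<union> (T - S)) \<inter> X = ((S - T) \<inter> X) \<union> ((T - S) \<inter> X)" by blast
  have "card (S \<inter> X) = card ((S - T) \<inter> X) + card (S \<inter> T \<inter> X)"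
    by (subst S, rule card_Un_disjoint) (use assms in auto)
  moreover have "card (T \<inter> X) = card ((T - S) \<inter> X) + card (S \<inter> T \<inter> X)"
    by (subst T, rule card_Un_disjoint) (use assms in auto)
  moreover have "card (((S - T) \<union> (T - S)) \<inter> X) = card ((S - T) \<inter> X) + card ((T - S) \<inter> X)"
    by (subst ST, rule card_Un_disjoint) (use assms in auto)
  moreover have "(-1 :: 3) ^ k * (-1) ^ k = 1" for k
    by (simp flip: power_mult_distrib)
  ultimately show ?thesis
    by (simp add: chi_def power_add algebra_simps)
qed

lemma chi_in_deg:
  assumes "finite V" "S \<subseteq> V" "card S \<le> d"
  shows "chi S \<in> deg V d"
proof -
  have "chi S X = (\<Sum>T | T \<subseteq> V \<and> card T \<le> d. (if T = S then 1 else 0) * chi T X)" for X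
    using assms by (simp add: if_distrib[of "\<lambda>a. a * _"] cong: if_cong)
  then show ?thesis unfolding deg_def by (intro CollectI exI allI)
qed

lemma deg_scale: "f \<in> deg V d \<Longrightarrow> (\<lambda>X. a * f X) \<in> deg V d"
proof -
  assume "f \<in> deg V d"
  then obtain c where "\<forall>X. f X = (\<Sum>S | S \<subseteq> V \<and> card S \<le> d. c S * chi S X)"
    unfolding deg_def by blast
  then have "a * f X = (\<Sum>S | S \<subseteq> V \<and> card S \<le> d. (a * c S) * chi S X)" for X
    by (simp add: sum_distrib_left mult.assoc)
  then show ?thesis unfolding deg_def by (intro CollectI exI allI)
qed

lemma deg_zero: "(\<lambda>X. 0) \<in> deg V d"
  unfolding deg_def by (intro CollectI exI[of _ "\<lambda>_. 0"]) simp

lemma deg_add: "f \<in> deg V d \<Longrightarrow> g \<in> deg V d \<Longrightarrow> (\<lambda>X. f X + g X) \<in> deg V d"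
proof -
  assume "f \<in> deg V d" "g \<in> deg V d"
  then obtain b c where "\<forall>X. f X = (\<Sum>S | S \<subseteq> V \<and> card S \<le> d. b S * chi S X)"
    "\<forall>X. g X = (\<Sum>S | S \<subseteq> V \<and> card S \<le> d. c S * chi S X)"
    unfolding deg_def by blast
  then have "f X + g X = (\<Sum>S | S \<subseteq> V \<and> card S \<le> d. (b S + c S) * chi S X)" for X
    by (simp add: sum.distrib distrib_right)
  then show ?thesis unfolding deg_def by (intro CollectI exI allI)
qed

lemma deg_sum: "(\<And>i. i \<in> I \<Longrightarrow> f i \<in> deg V d) \<Longrightarrow> (\<lambda>X. \<Sum>i\<in>I. f i X) \<in> deg V d"
  by (induction I rule: infinite_finite_induct) (simp_all add: deg_zero deg_add)

lemma deg_const: "finite V \<Longrightarrow> (\<lambda>X. a) \<in> deg V d"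
  using deg_scale[OF chi_in_deg[of V "{}" d], of a] by simp

lemma deg_diff: "f \<in> deg V d \<Longrightarrow> g \<in> deg V d \<Longrightarrow> (\<lambda>X. f X - g X) \<in> deg V d"
  using deg_add[OF _ deg_scale[of g V d "-1"], of f] by simp

lemma deg_mono:
  assumes "finite V" "d \<le> e" "f \<in> deg V d"
  shows "f \<in> deg V e"
proof -
  obtain c where c: "\<forall>X. f X = (\<Sum>S | S \<subseteq> V \<and> card S \<le> d. c S * chi S X)"
    using assms(3) unfolding deg_def by blast
  have "(\<lambda>X. \<Sum>S | S \<subseteq> V \<and> card S \<le> d. c S * chi S X) \<in> deg V e"
    using assms by (intro deg_sum deg_scale chi_in_deg) auto
  moreover have "f = (\<lambda>X. \<Sum>S | S \<subseteq> V \<and> card S \<le> d. c S * chi S X)" using c by auto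
  ultimately show ?thesis by metis
qed

lemma deg_mult:
  assumes V: "finite V" and f: "f \<in> deg V d" and g: "g \<in> deg V e"
  shows "(\<lambda>X. f X * g X) \<in> deg V (d + e)"
proof -
  obtain b where b: "\<forall>X. f X = (\<Sum>S | S \<subseteq> V \<and> card S \<le> d. b S * chi S X)"
    using f unfolding deg_def by blast
  obtain c where c: "\<forall>X. g X = (\<Sum>S | S \<subseteq> V \<and> card S \<le> e. c S * chi S X)"
    using g unfolding deg_def by blast
  have "f X * g X = (\<Sum>S | S \<subseteq> V \<and> card S \<le> d. \<Sum>T | T \<subseteq> V \<and> card T \<le> e.
      (b S * c T) * chi ((S - T) \<union> (T - S)) X)" for X
    unfolding b[rule_format] c[rule_format] sum_product
    by (intro sum.cong refl, subst chi_mult[symmetric])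
       (use V finite_subset in \<open>auto simp: algebra_simps\<close>)
  moreover have "(\<lambda>X. \<Sum>S | S \<subseteq> V \<and> card S \<le> d. \<Sum>T | T \<subseteq> V \<and> card T \<le> e.
      (b S * c T) * chi ((S - T) \<union> (T - S)) X) \<in> deg V (d + e)"
  proof (intro deg_sum deg_scale chi_in_deg V)
    fix S T assume ST: "S \<in> {S. S \<subseteq> V \<and> card S \<le> d}" "T \<in> {T. T \<subseteq> V \<and> card T \<le> e}"
    then show "S - T \<union> (T - S) \<subseteq> V" by blast
    have "card (S - T \<union> (T - S)) \<le> card (S \<union> T)"
      using ST V finite_subset by (intro card_mono) auto
    also have "\<dots> \<le> card S + card T" by (rule card_Un_le)
    finally show "card (S - T \<union> (T - S)) \<le> d + e" using ST by simp
  qed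
  ultimately show ?thesis by simp
qed

lemma deg_prod:
  assumes V: "finite V" and "finite I" "card I \<le> k" "\<And>i. i \<in> I \<Longrightarrow> f i \<in> deg V d"
  shows "(\<lambda>X. \<Prod>i\<in>I. f i X) \<in> deg V (k * d)"
proof -
  have "(\<lambda>X. \<Prod>i\<in>I. f i X) \<in> deg V (card I * d)"
    using assms(2,4) by (induction I rule: finite_induct) (simp_all add: deg_const deg_mult V)
  then show ?thesis using assms by (blast intro: deg_mono mult_le_mono1)
qed

lemma chi_single: "chi {v} X = (if v \<in> X then -1 else 1)"
  by (simp add: chi_def)

text \<open>This is -2 = 1 in characteristic 3; the same identity underlies
  \<open>chi_single_agree\<close>.\<close>

lemma of_bool_eq_chi: "of_bool (v \<in> X) = chi {v} X - 1"
  by (simp add: chi_single)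

lemma deg_variable:
  assumes "finite V" "v \<in> V"
  shows "(\<lambda>X. of_bool (v \<in> X)) \<in> deg V 1"
  unfolding of_bool_eq_chi using assms by (intro deg_diff chi_in_deg deg_const) auto

lemma prod_of_bool:
  "finite A \<Longrightarrow> (\<Prod>x\<in>A. of_bool (P x)) = (of_bool (\<forall>x\<in>A. P x) :: 'a :: comm_semiring_1)"
  by (induction A rule: finite_induct) auto

lemma chi_single_agree: "- 1 - chi {v} Y * chi {v} X = of_bool ((v \<in> X) = (v \<in> Y))"
  by (simp add: chi_single)

lemma deg_indicator:
  assumes "finite V" "Y \<subseteq> V"
  shows "\<exists>f\<in>deg V (card V). \<forall>X\<subseteq>V. f X = of_bool (X = Y)"
proof
  let ?f = "\<lambda>X. \<Prod>v\<in>V. - 1 - chi {v} Y * chi {v} X"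
  have "?f \<in> deg V (card V * 1)"
    using assms by (intro deg_prod deg_diff deg_scale deg_const chi_in_deg) auto
  then show "?f \<in> deg V (card V)" by simp
  have "(\<forall>v\<in>V. (v \<in> X) = (v \<in> Y)) = (X = Y)" if "X \<subseteq> V" for X
    using that assms(2) by blast
  then show "\<forall>X\<subseteq>V. ?f X = of_bool (X = Y)"
    unfolding chi_single_agree prod_of_bool[OF assms(1)] by simp
qed

lemma deg_all:
  assumes "finite V"
  shows "\<exists>f\<in>deg V (card V). \<forall>X\<subseteq>V. f X = g X"
proof -
  obtain I where I: "\<And>Y. Y \<subseteq> V \<Longrightarrow> I Y \<in> deg V (card V)"
    and Ieq: "\<And>X Y. X \<subseteq> V \<Longrightarrow> Y \<subseteq> V \<Longrightarrow> I Y X = of_bool (X = Y)"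
    using deg_indicator[OF assms] by metis
  have "(\<lambda>X. \<Sum>Y\<in>Pow V. g Y * I Y X) \<in> deg V (card V)"
    by (intro deg_sum deg_scale I) (simp add: Pow_iff)
  moreover have "(\<Sum>Y\<in>Pow V. g Y * I Y X) = g X" if "X \<subseteq> V" for X
  proof -
    have "(\<Sum>Y\<in>Pow V. g Y * I Y X) = (\<Sum>Y\<in>Pow V. if X = Y then g Y else 0)"
      by (rule sum.cong) (simp_all add: Ieq that)
    also have "\<dots> = g X" using assms that by (subst sum.delta') auto
    finally show ?thesis .
  qed
  ultimately show ?thesis by (intro bexI[of _ "\<lambda>X. \<Sum>Y\<in>Pow V. g Y * I Y X"]) simp_all
qed

section \<open>Smolensky's dimension bound\<close>

text \<open>Counting replaces linear algebra: there are \<open>3 ^ card G\<close> functions on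
  \<open>G\<close>, and each arises from one of the \<open>3 ^ card K\<close> choices of
  coefficients, where \<open>K\<close> is the set of admissible characters.\<close>

lemma card_le_of_deg_interpolation:
  assumes "finite V" "G \<subseteq> Pow V" and ex: "\<And>g. \<exists>f\<in>deg V d. \<forall>X\<in>G. f X = g X"
  shows "card G \<le> card {S. S \<subseteq> V \<and> card S \<le> d}"
proof -
  let ?K = "{S. S \<subseteq> V \<and> card S \<le> d}"
  have fin: "finite G" "finite ?K" using assms(1,2) finite_subset[of G "Pow V"] by auto
  have "PiE G (\<lambda>_. UNIV :: 3 set) \<subseteq>
    (\<lambda>c. restrict (\<lambda>X. \<Sum>S\<in>?K. c S * chi S X) G) ` PiE ?K (\<lambda>_. UNIV)"
  proof
    fix g assume g: "g \<in> PiE G (\<lambda>_. UNIV :: 3 set)"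
    obtain f c where f: "\<forall>X\<in>G. f X = g X" and c: "\<forall>X. f X = (\<Sum>S\<in>?K. c S * chi S X)"
      using ex[of g] unfolding deg_def by blast
    have "restrict (\<lambda>X. \<Sum>S\<in>?K. (restrict c ?K) S * chi S X) G = g"
    proof
      fix X
      have "(\<Sum>S\<in>?K. (restrict c ?K) S * chi S X) = f X"
        unfolding c[rule_format] by (intro sum.cong) auto
      then show "restrict (\<lambda>X. \<Sum>S\<in>?K. (restrict c ?K) S * chi S X) G X = g X"
        using f g by (auto simp: restrict_def PiE_def extensional_def)
    qed
    then show "g \<in> (\<lambda>c. restrict (\<lambda>X. \<Sum>S\<in>?K. c S * chi S X) G) ` PiE ?K (\<lambda>_. UNIV)"
      by (intro image_eqI[of _ _ "restrict c ?K"]) auto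
  qed
  then have "card (PiE G (\<lambda>_. UNIV :: 3 set)) \<le> card (PiE ?K (\<lambda>_. UNIV :: 3 set))"
    using fin by (intro surj_card_le finite_PiE) auto
  then have "(3::nat) ^ card G \<le> 3 ^ card ?K" using fin by (simp add: card_PiE)
  then show ?thesis by simp
qed

text \<open>Smolensky's argument: where \<open>p\<close> computes parity, \<open>chi S = chi V * chi (V - S)\<close> turns a character of large
  degree into \<open>1 + p\<close> times one of small degree, so every function on \<open>G\<close> has degree at most \<open>h + D\<close>.\<close>

lemma card_le_of_parity_approx:
  assumes V: "finite V" "card V = 2 * h" and G: "G \<subseteq> Pow V"
    and p: "p \<in> deg V D" "\<And>X. X \<in> G \<Longrightarrow> p X = of_bool (odd (card X))"
  shows "card G \<le> card {S. S \<subseteq> V \<and> card S \<le> h + D}"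
proof (rule card_le_of_deg_interpolation[OF V(1) G])
  fix g :: "'a set \<Rightarrow> 3"
  obtain f where f: "f \<in> deg V (card V)" "\<forall>X\<subseteq>V. f X = g X" using deg_all[OF V(1)] by blast
  then obtain c where c: "\<forall>X. f X = (\<Sum>S | S \<subseteq> V \<and> card S \<le> card V. c S * chi S X)"
    unfolding deg_def by blast
  let ?q = "\<lambda>X. 1 + p X"
  have q: "?q \<in> deg V D" using p V by (intro deg_add deg_const) auto
  have qV: "?q X = chi V X" if "X \<in> G" for X
  proof -
    have "V \<inter> X = X" using that G by auto
    then show ?thesis using p(2)[OF that] by (simp add: chi_def)
  qed
  define r where "r S = (if card S \<le> h then chi S else (\<lambda>X. ?q X * chi (V - S) X))" for S
  have rdeg: "r S \<in> deg V (h + D)" if "S \<subseteq> V" for S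
  proof (cases "card S \<le> h")
    case True
    then show ?thesis using that V by (simp add: r_def chi_in_deg)
  next
    case False
    have "card (V - S) \<le> h" using that V False by (simp add: card_Diff_subset finite_subset)
    then have "(\<lambda>X. ?q X * chi (V - S) X) \<in> deg V (D + h)"
      by (intro deg_mult q chi_in_deg V(1)) auto
    then show ?thesis using False by (simp add: r_def add.commute)
  qed
  have reval: "r S X = chi S X" if "S \<subseteq> V" "X \<in> G" for S X
  proof (cases "card S \<le> h")
    case True
    then show ?thesis by (simp add: r_def)
  next
    case False
    have "V - (V - S) \<union> (V - S - V) = S" using that by blast
    then show ?thesis using False that V by (simp add: r_def qV chi_mult)
  qed
  show "\<exists>f\<in>deg V (h + D). \<forall>X\<in>G. f X = g X"
  proof
    show "(\<lambda>X. \<Sum>S | S \<subseteq> V \<and> card S \<le> card V. c S * r S X) \<in> deg V (h + D)"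
      by (intro deg_sum deg_scale rdeg) auto
    show "\<forall>X\<in>G. (\<Sum>S | S \<subseteq> V \<and> card S \<le> card V. c S * r S X) = g X"
    proof
      fix X assume X: "X \<in> G"
      have "(\<Sum>S | S \<subseteq> V \<and> card S \<le> card V. c S * r S X) = f X"
        unfolding c[rule_format] using X by (intro sum.cong refl) (simp add: reval)
      then show "(\<Sum>S | S \<subseteq> V \<and> card S \<le> card V. c S * r S X) = g X" using f X G by auto
    qed
  qed
qed

section \<open>Estimates for binomial coefficients around the middle\<close>

lemma central_binomial_Suc:
  "Suc h * ((2 * Suc h) choose (Suc h)) = 2 * (2 * h + 1) * ((2 * h) choose h)"
proof -
  define c where "c = Suc (2 * h) choose h"
  have e: "2 * Suc h = Suc (Suc (2 * h))" by simp
  have 1: "Suc h * ((2 * Suc h) choose (Suc h)) = (2 * Suc h) * c"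
    unfolding c_def e using Suc_times_binomial_eq[of "Suc (2 * h)" h] by (simp only: mult.commute)
  have "c = (Suc (2 * h)) choose (Suc h)"
    unfolding c_def by (subst binomial_symmetric) (auto simp del: binomial_Suc_Suc)
  then have 2: "Suc h * c = Suc (2 * h) * ((2 * h) choose h)"
    using Suc_times_binomial_eq[of "2 * h" h] by (simp only: mult.commute)
  have "Suc h * ((2 * Suc h) choose (Suc h)) = 2 * (Suc h * c)" unfolding 1 by (simp only: mult_ac)
  then show ?thesis unfolding 2 by (simp only: mult_ac Suc_eq_plus1)
qed

text \<open>The squared form of the bound \<open>4 ^ h / sqrt (2 * h + 1)\<close>, which stays
  within the natural numbers. The induction rests on (2h + 1)(2h + 3) \<le> 4(h + 1)^2.\<close>

lemma central_binomial_bound: "(2 * h + 1) * ((2 * h) choose h)\<^sup>2 \<le> 16 ^ h"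
proof (induction h)
  case 0
  then show ?case by simp
next
  case (Suc h)
  define a b where "a = (2 * h) choose h" and "b = (2 * Suc h) choose (Suc h)"
  have e: "2 * Suc h + 1 = 2 * h + 3" by simp
  have "(Suc h)\<^sup>2 * ((2 * Suc h + 1) * b\<^sup>2) = (2 * h + 3) * (Suc h * b)\<^sup>2"
    unfolding e power_mult_distrib by (simp only: mult_ac)
  also have "\<dots> = 4 * ((2 * h + 3) * (2 * h + 1)) * ((2 * h + 1) * a\<^sup>2)"
    unfolding a_def[symmetric] b_def central_binomial_Suc by (simp add: power2_eq_square algebra_simps)
  also have "\<dots> \<le> (16 * (Suc h)\<^sup>2) * 16 ^ h"
    using Suc.IH unfolding a_def by (intro mult_le_mono[of "4 * _"]) (simp_all add: power2_eq_square algebra_simps)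
  finally have "(Suc h)\<^sup>2 * ((2 * Suc h + 1) * b\<^sup>2) \<le> (Suc h)\<^sup>2 * 16 ^ Suc h"
    by (simp only: power_Suc mult_ac)
  then show ?case unfolding b_def by (simp only: mult_le_cancel1) simp
qed

lemma sum_binomial_lower_half: "2 * (\<Sum>i<h. (2 * h) choose i) \<le> 2 ^ (2 * h)"
proof -
  have "(\<Sum>i<h. (2 * h) choose i) = (\<Sum>i\<in>{h<..2 * h}. (2 * h) choose i)"
    by (rule sum.reindex_bij_witness[of _ "\<lambda>i. 2 * h - i" "\<lambda>i. 2 * h - i"])
       (auto intro: binomial_symmetric[symmetric])
  then have "2 * (\<Sum>i<h. (2 * h) choose i) =
      (\<Sum>i<h. (2 * h) choose i) + (\<Sum>i\<in>{h<..2 * h}. (2 * h) choose i)" by simp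
  also have "\<dots> = (\<Sum>i\<in>{..<h} \<union> {h<..2 * h}. (2 * h) choose i)"
    by (rule sum.union_disjoint[symmetric]) auto
  also have "\<dots> \<le> (\<Sum>i\<le>2 * h. (2 * h) choose i)" by (rule sum_mono2) auto
  finally show ?thesis by (simp add: choose_row_sum)
qed

text \<open>By symmetry the layers below \<open>h\<close> hold at most half of all subsets; each of
  the remaining \<open>D + 1\<close> layers is at most the middle one.\<close>

lemma card_small_subsets:
  assumes "finite V" "card V = 2 * h"
  shows "2 * card {S. S \<subseteq> V \<and> card S \<le> h + D} \<le> 2 ^ (2 * h) + 2 * (D + 1) * ((2 * h) choose h)"
proof -
  have "{S. S \<subseteq> V \<and> card S \<le> h + D} = (\<Union>i\<le>h + D. {S. S \<subseteq> V \<and> card S = i})" by auto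
  then have "card {S. S \<subseteq> V \<and> card S \<le> h + D} \<le> (\<Sum>i\<le>h + D. card {S. S \<subseteq> V \<and> card S = i})"
    by (simp add: card_UN_le)
  also have "\<dots> = (\<Sum>i\<le>h + D. (2 * h) choose i)" using assms by (simp add: n_subsets)
  also have "\<dots> = (\<Sum>i\<in>{..<h} \<union> {h..h + D}. (2 * h) choose i)" by (rule sum.cong) auto
  also have "\<dots> = (\<Sum>i<h. (2 * h) choose i) + (\<Sum>i\<in>{h..h + D}. (2 * h) choose i)"
    by (rule sum.union_disjoint) auto
  also have "(\<Sum>i\<in>{h..h + D}. (2 * h) choose i) \<le> (\<Sum>i\<in>{h..h + D}. (2 * h) choose h)"
    by (intro sum_mono binomial_maximum')
  finally show ?thesis using sum_binomial_lower_half[of h] by simp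
qed

text \<open>Off \<open>E\<close> there remain at least 7/8 of all inputs, and the dimension bound
  allows 1/2 plus \<open>D + 1\<close> middle layers. So these layers would have to hold 3/8 of all
  inputs; squaring and inserting the bound on \<open>D\<close> gives
  \<open>9 * 16 ^ h \<le> 8 * 16 ^ h\<close>.\<close>

lemma parity_not_approximable:
  assumes V: "finite V" "card V = 2 * h" and D: "8 * (D + 1)\<^sup>2 \<le> 2 * h"
    and E: "8 * card E \<le> 2 ^ card V" "E \<subseteq> Pow V"
    and p: "p \<in> deg V D"
  shows "\<exists>X\<in>Pow V - E. p X \<noteq> of_bool (odd (card X))"
proof (rule ccontr)
  assume "\<not> ?thesis"
  then have "card (Pow V - E) \<le> card {S. S \<subseteq> V \<and> card S \<le> h + D}"
    by (intro card_le_of_parity_approx[OF V _ p]) auto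
  also have "2 * \<dots> \<le> 2 ^ (2 * h) + 2 * (D + 1) * ((2 * h) choose h)"
    by (rule card_small_subsets[OF V])
  finally have le: "2 * card (Pow V - E) \<le> 2 ^ (2 * h) + 2 * (D + 1) * ((2 * h) choose h)" by simp
  have "card (Pow V - E) = 2 ^ (2 * h) - card E"
    using E V by (simp add: card_Diff_subset card_Pow finite_subset)
  then have "3 * 2 ^ (2 * h) \<le> 8 * ((D + 1) * ((2 * h) choose h))"
    using le E V by simp
  then have "(3 * 2 ^ (2 * h))\<^sup>2 \<le> (8 * ((D + 1) * ((2 * h) choose h)))\<^sup>2"
    by (rule power_mono) simp
  also have "\<dots> = 8 * (8 * (D + 1)\<^sup>2) * ((2 * h) choose h)\<^sup>2"
    by (simp add: power2_eq_square algebra_simps)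
  also have "\<dots> \<le> 8 * (2 * h + 1) * ((2 * h) choose h)\<^sup>2"
    using D by (intro mult_le_mono) auto
  also have "\<dots> \<le> 8 * 16 ^ h"
    unfolding mult.assoc by (intro mult_le_mono2 central_binomial_bound)
  also have "(3 * 2 ^ (2 * h))\<^sup>2 = 9 * (16::nat) ^ h"
  proof -
    have "(2::nat) ^ (2 * h) = 4 ^ h" by (simp add: power_mult)
    moreover have "(4::nat) ^ h * 4 ^ h = 16 ^ h" by (simp flip: power_mult_distrib)
    ultimately show ?thesis by (simp add: power2_eq_square)
  qed
  finally show False by simp
qed


section \<open>Razborov's approximation of disjunctions\<close>

text \<open>Toggling membership of \<open>i\<close> changes the sum by 1 or -1, so it maps the
  subsets with sum zero injectively to subsets with nonzero sum.\<close>

lemma card_zero_subset_sums: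
  fixes b :: "'i \<Rightarrow> 3"
  assumes I: "finite I" "i \<in> I" "b i = 1"
  shows "2 * card {S \<in> Pow I. sum b S = 0} \<le> card (Pow I)"
proof -
  let ?Z = "{S \<in> Pow I. sum b S = 0}" and ?N = "{S \<in> Pow I. sum b S \<noteq> 0}"
  let ?t = "\<lambda>S. if i \<in> S then S - {i} else insert i S"
  have "card ?Z \<le> card ?N"
  proof (rule card_inj_on_le)
    show "inj_on ?t ?Z" by (rule inj_on_inverseI[of _ ?t]) auto
    show "?t ` ?Z \<subseteq> ?N"
    proof
      fix T assume "T \<in> ?t ` ?Z"
      then obtain S where S: "S \<subseteq> I" "sum b S = 0" "T = ?t S" by auto
      have fin: "finite S" using S I finite_subset by blast
      have "sum b T = (if i \<in> S then -1 else 1)"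
        using S I fin by (auto simp: sum_diff1)
      then show "T \<in> ?N" using S I by (auto split: if_splits)
    qed
    show "finite ?N" using I by simp
  qed
  moreover have "card (Pow I) = card ?Z + card ?N"
    using I by (subst card_Un_disjoint[symmetric]) (auto intro!: arg_cong[where f = card])
  ultimately show ?thesis by simp
qed

text \<open>Averaging: the pairs \<open>(S, X)\<close> with \<open>P S X\<close> are counted in both
  orders, and some \<open>S\<close> is no worse than the mean. This replaces the random choice of
  \<open>S\<close>.\<close>

lemma exists_halving:
  assumes "finite J" "finite B"
    and le: "\<And>X. X \<in> B \<Longrightarrow> 2 * card {S \<in> J. P S X} \<le> card J" and "J \<noteq> {}"
  shows "\<exists>S\<in>J. 2 * card {X \<in> B. P S X} \<le> card B"
proof (rule ccontr)
  assume "\<not> ?thesis"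
  then have "(\<Sum>S\<in>J. card B) < (\<Sum>S\<in>J. 2 * card {X \<in> B. P S X})"
    using assms by (intro sum_strict_mono) auto
  also have "\<dots> = 2 * (\<Sum>S\<in>J. \<Sum>X\<in>B. of_bool (P S X))"
    using assms by (simp add: sum_distrib_left Collect_conj_eq Int_commute)
  also have "\<dots> = 2 * (\<Sum>X\<in>B. \<Sum>S\<in>J. of_bool (P S X))" by (subst sum.swap) simp
  also have "\<dots> = (\<Sum>X\<in>B. 2 * card {S \<in> J. P S X})"
    using assms by (simp add: sum_distrib_left Collect_conj_eq Int_commute)
  also have "\<dots> \<le> (\<Sum>X\<in>B. card J)" by (intro sum_mono le)
  finally show False by simp
qed

text \<open>Razborov's approximation: for a suitable set \<open>S\<close> of indices, the square of \<open>\<Sum>i\<in>S. p i X\<close> (which is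
  0 or 1 in characteristic 3) detects the disjunction on at least half of the inputs missed so far.\<close>

lemma or_approx_aux:
  assumes V: "finite V" and I: "finite I" and p: "\<And>i. i \<in> I \<Longrightarrow> p i \<in> deg V d"
    and pa: "\<And>i X. i \<in> I \<Longrightarrow> X \<in> Pow V - E \<Longrightarrow> p i X = of_bool (a i X)"
  shows "\<exists>g\<in>deg V (l * (2 * d)). (\<forall>X\<in>Pow V - E. (\<forall>i\<in>I. \<not> a i X) \<longrightarrow> g X = 1) \<and>
    2 ^ l * card {X \<in> Pow V - E. (\<exists>i\<in>I. a i X) \<and> g X \<noteq> 0} \<le> 2 ^ card V"
proof (induction l)
  case 0
  have "card {X \<in> Pow V - E. \<exists>i\<in>I. a i X} \<le> card (Pow V)" using V by (intro card_mono) auto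
  then show ?case using V by (intro bexI[of _ "\<lambda>_. 1"] deg_const) (auto simp: card_Pow)
next
  case (Suc l)
  then obtain g where g: "g \<in> deg V (l * (2 * d))"
    "\<And>X. X \<in> Pow V - E \<Longrightarrow> \<forall>i\<in>I. \<not> a i X \<Longrightarrow> g X = 1"
    "2 ^ l * card {X \<in> Pow V - E. (\<exists>i\<in>I. a i X) \<and> g X \<noteq> 0} \<le> 2 ^ card V" by blast
  \<comment> \<open>\<open>g\<close> approximates the negated disjunction, and \<open>B\<close> is
    where it is still wrong. Multiplying \<open>g\<close> by the zero test \<open>f\<close> of a
    halving set \<open>S\<close> at least halves \<open>B\<close> at the cost of degree
    \<open>2 * d\<close>.\<close>
  define B where "B = {X \<in> Pow V - E. (\<exists>i\<in>I. a i X) \<and> g X \<noteq> 0}"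
  have "\<exists>S\<in>Pow I. 2 * card {X \<in> B. (\<Sum>i\<in>S. p i X) = 0} \<le> card B"
  proof (rule exists_halving)
    show "finite B" unfolding B_def using V by simp
    fix X assume "X \<in> B"
    then obtain i where "i \<in> I" "a i X" and "X \<in> Pow V - E" unfolding B_def by blast
    then show "2 * card {S \<in> Pow I. (\<Sum>i\<in>S. p i X) = 0} \<le> card (Pow I)"
      using pa by (intro card_zero_subset_sums I) auto
  qed (use I in auto)
  then obtain S where S: "S \<subseteq> I" "2 * card {X \<in> B. (\<Sum>i\<in>S. p i X) = 0} \<le> card B" by blast
  define f where "f X = 1 - (\<Sum>i\<in>S. p i X) * (\<Sum>i\<in>S. p i X)" for X
  have fdeg: "f \<in> deg V (2 * d)"
    unfolding f_def mult_2 using S p V by (intro deg_diff deg_mult deg_sum deg_const) auto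
  have f: "f X = (if (\<Sum>i\<in>S. p i X) = 0 then 1 else 0)" for X
    unfolding f_def using three_cases[of "\<Sum>i\<in>S. p i X"] by auto
  show ?case
  proof (intro bexI[of _ "\<lambda>X. f X * g X"] conjI ballI impI)
    show "(\<lambda>X. f X * g X) \<in> deg V (Suc l * (2 * d))"
      using deg_mult[OF V fdeg g(1)] by simp
    fix X assume X: "X \<in> Pow V - E" "\<forall>i\<in>I. \<not> a i X"
    then have "(\<Sum>i\<in>S. p i X) = 0" using pa S by (intro sum.neutral) auto
    then show "f X * g X = 1" using g X f by simp
  next
    have "{X \<in> Pow V - E. (\<exists>i\<in>I. a i X) \<and> f X * g X \<noteq> 0} = {X \<in> B. (\<Sum>i\<in>S. p i X) = 0}"
      unfolding B_def f by auto
    then have "2 * card {X \<in> Pow V - E. (\<exists>i\<in>I. a i X) \<and> f X * g X \<noteq> 0} \<le> card B" using S by simp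
    then have "2 ^ l * (2 * card {X \<in> Pow V - E. (\<exists>i\<in>I. a i X) \<and> f X * g X \<noteq> 0}) \<le> 2 ^ l * card B"
      by (rule mult_le_mono2)
    also have "\<dots> \<le> 2 ^ card V" using g(3) unfolding B_def .
    finally show "2 ^ Suc l * card {X \<in> Pow V - E. (\<exists>i\<in>I. a i X) \<and> f X * g X \<noteq> 0} \<le> 2 ^ card V"
      by (simp add: mult_ac)
  qed
qed

text \<open>\<open>F\<close> holds only the errors made by this disjunction. The errors
  \<open>E\<close> of its arguments are kept apart, so that those shared by many disjunctions are
  counted once.\<close>

lemma or_approx:
  assumes V: "finite V" and I: "finite I" and p: "\<And>i. i \<in> I \<Longrightarrow> p i \<in> deg V d"
    and pa: "\<And>i X. i \<in> I \<Longrightarrow> X \<in> Pow V - E \<Longrightarrow> p i X = of_bool (a i X)"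
  shows "\<exists>g\<in>deg V (l * (2 * d)). \<exists>F\<subseteq>Pow V. 2 ^ l * card F \<le> 2 ^ card V \<and>
    (\<forall>X\<in>Pow V - (E \<union> F). g X = of_bool (\<exists>i\<in>I. a i X))"
proof -
  obtain g where g: "g \<in> deg V (l * (2 * d))"
    "\<And>X. X \<in> Pow V - E \<Longrightarrow> \<forall>i\<in>I. \<not> a i X \<Longrightarrow> g X = 1"
    "2 ^ l * card {X \<in> Pow V - E. (\<exists>i\<in>I. a i X) \<and> g X \<noteq> 0} \<le> 2 ^ card V"
    using or_approx_aux[of V I p d E a l] assms by blast
  show ?thesis
  proof (intro bexI[of _ "\<lambda>X. 1 - g X"] exI[of _ "{X \<in> Pow V - E. (\<exists>i\<in>I. a i X) \<and> g X \<noteq> 0}"] conjI ballI)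
    show "(\<lambda>X. 1 - g X) \<in> deg V (l * (2 * d))" by (intro deg_diff deg_const V g)
    fix X assume X: "X \<in> Pow V - (E \<union> {X \<in> Pow V - E. (\<exists>i\<in>I. a i X) \<and> g X \<noteq> 0})"
    show "1 - g X = of_bool (\<exists>i\<in>I. a i X)"
    proof (cases "\<exists>i\<in>I. a i X")
      case True
      then have "g X = 0" using X by blast
      then show ?thesis using True by simp
    next
      case False
      then have "g X = 1" using X g(2) by blast
      then show ?thesis using False by simp
    qed
  qed (use g in auto)
qed

text \<open>A conjunction of at most \<open>s\<close> literals is exactly a product of
  \<open>s\<close> factors, so it only multiplies the degree by \<open>s\<close>. All errors come
  from the disjunction, whose number of terms is irrelevant to the bounds.\<close>

lemma dnf_approx:
  assumes V: "finite V" and R: "finite R"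
    and lits: "\<And>r. r \<in> R \<Longrightarrow> length r \<le> s \<and> fst ` set r \<subseteq> Q"
    and P: "\<And>q. q \<in> Q \<Longrightarrow> P q \<in> deg V d"
    and Ph: "\<And>q X. q \<in> Q \<Longrightarrow> X \<in> Pow V - E \<Longrightarrow> P q X = of_bool (h q X)"
  shows "\<exists>g\<in>deg V (l * (2 * (s * d))). \<exists>F\<subseteq>Pow V. 2 ^ l * card F \<le> 2 ^ card V \<and>
    (\<forall>X\<in>Pow V - (E \<union> F). g X = of_bool (\<exists>r\<in>R. \<forall>(q, b)\<in>set r. h q X = b))"
proof (rule or_approx[OF V R, where p = "\<lambda>r X. \<Prod>(q, b)\<in>set r. if b then P q X else 1 - P q X"])
  fix r assume r: "r \<in> R"
  have "card (set r) \<le> s" using lits[OF r] card_length[of r] by linarith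
  moreover have "(\<lambda>X. if b then P q X else 1 - P q X) \<in> deg V d" if "(q, b) \<in> set r" for q b
  proof -
    have "q \<in> Q" using lits[OF r] that by force
    then show ?thesis using P V by (cases b) (auto intro!: deg_diff deg_const)
  qed
  ultimately show "(\<lambda>X. \<Prod>(q, b)\<in>set r. if b then P q X else 1 - P q X) \<in> deg V (s * d)"
    using deg_prod[OF V, of "set r" s "\<lambda>(q, b) X. if b then P q X else 1 - P q X" d]
    by (auto simp: case_prod_beta)
  fix X assume X: "X \<in> Pow V - E"
  have "(\<Prod>(q, b)\<in>set r. if b then P q X else 1 - P q X) = (\<Prod>(q, b)\<in>set r. of_bool (h q X = b))"
    using Ph[OF _ X] lits[OF r] by (intro prod.cong) (force split: if_splits)+
  then show "(\<Prod>(q, b)\<in>set r. if b then P q X else 1 - P q X) = of_bool (\<forall>(q, b)\<in>set r. h q X = b)"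
    by (simp add: prod_of_bool case_prod_beta)
qed

section \<open>Oracle computations as decision trees of queries\<close>

lemma poly_nat_mono: "m \<le> n \<Longrightarrow> poly p m \<le> poly (p :: nat poly) n"
  by (auto simp: poly_altdef intro!: sum_mono mult_le_mono2 power_mono)

lemma finite_strings_le: "finite {q :: bool list. length q \<le> n}"
  using finite_lists_length_le[of "UNIV :: bool set" n] by simp

text \<open>Runs whose query answers are guessed: \<open>r\<close> lists the queries with the guessed answers, latest first, and
  \<open>K\<close> restricts the configurations entered. The oracle only comes in through \<open>agrees\<close>.\<close>

inductive run :: "otm \<Rightarrow> (config \<Rightarrow> bool) \<Rightarrow> nat \<Rightarrow> config \<Rightarrow> (bool list \<times> bool) list \<Rightarrow> config \<Rightarrow> bool"
  for M K where
  run_0: "run M K 0 c [] c"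
| run_instr: "\<lbrakk>run M K n c r c'; i \<in> set (program M); state c' \<noteq> query M; source i = state c';
    scan i = scanned M c'; K (exec M i c')\<rbrakk> \<Longrightarrow> run M K (Suc n) c r (exec M i c')"
| run_query: "\<lbrakk>run M K n c r c'; state c' = query M;
    K (Config (if b then yes M else no M) (tape c') (head c'))\<rbrakk>
    \<Longrightarrow> run M K (Suc n) c ((query_string c', b) # r) (Config (if b then yes M else no M) (tape c') (head c'))"

definition agrees :: "bool list set \<Rightarrow> (bool list \<times> bool) list \<Rightarrow> bool" where
  "agrees B r \<longleftrightarrow> (\<forall>(q, b)\<in>set r. (q \<in> B) = b)"

lemma run_imp_relpowp:
  "run M K n c r c' \<Longrightarrow> agrees B r \<Longrightarrow> ((\<lambda>c c'. step M B c c' \<and> K c') ^^ n) c c'"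
proof (induction rule: run.induct)
  case (run_0 c)
  then show ?case by simp
next
  case (run_instr n c r c' i)
  then have "step M B c' (exec M i c')" by (auto intro: step_instr)
  then show ?case using run_instr by (auto intro: relpowp_Suc_I)
next
  case (run_query n c r c' b)
  then have "b = (query_string c' \<in> B)" by (simp add: agrees_def)
  then have "step M B c' (Config (if b then yes M else no M) (tape c') (head c'))"
    using run_query step_query[of c' M B] by simp
  then show ?case using run_query by (auto simp: agrees_def intro: relpowp_Suc_I)
qed

lemma relpowp_imp_run:
  "((\<lambda>c c'. step M B c c' \<and> K c') ^^ n) c c' \<Longrightarrow> \<exists>r. run M K n c r c' \<and> agrees B r"
proof (induction n arbitrary: c')
  case 0
  then show ?case by (auto simp: agrees_def intro: run_0)
next
  case (Suc n)
  then obtain d where "((\<lambda>c c'. step M B c c' \<and> K c') ^^ n) c d" and d: "step M B d c'" "K c'"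
    by (auto elim!: relpowp_Suc_E)
  then obtain r where r: "run M K n c r d" "agrees B r" using Suc.IH by blast
  from d(1) show ?case
  proof cases
    case (step_instr i)
    then show ?thesis using r d(2) by (auto intro: run_instr)
  next
    case step_query
    have "run M K (Suc n) c ((query_string d, query_string d \<in> B) # r) c'"
      unfolding step_query(1) using r step_query(2) d(2)[unfolded step_query(1)] by (intro run_query) auto
    then show ?thesis using r by (intro exI[of _ "(query_string d, query_string d \<in> B) # r"]) (simp add: agrees_def)
  qed
qed

lemma run_length: "run M K n c r c' \<Longrightarrow> length r \<le> n"
  by (induction rule: run.induct) auto

lemma abs_shift: "\<bar>shift m\<bar> \<le> 1"
  by (cases m) auto

lemma length_query_string:
  assumes "\<And>p. int s \<le> p \<Longrightarrow> tape c 1 p = 0"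
  shows "length (query_string c) \<le> s"
proof -
  have "tape c 1 (int s) \<notin> range bit_symbol" using assms[of "int s"] by (auto simp: bit_symbol_def)
  then show ?thesis unfolding query_string_def by (auto intro: Least_le)
qed

text \<open>The query tape starts blank and its head moves at most one cell per step, so after
  \<open>n\<close> steps the cells from \<open>n\<close> on are untouched.\<close>

lemma run_time_invariant:
  assumes "wf_otm M"
  shows "run M K n c r c' \<Longrightarrow> c = init M x \<Longrightarrow>
    \<bar>head c' 1\<bar> \<le> int n \<and> (\<forall>p\<ge>int n. tape c' 1 p = 0) \<and> (\<forall>(q, b)\<in>set r. length q \<le> n)"
proof (induction rule: run.induct)
  case (run_0 c)
  then show ?case by (simp add: init_def)
next
  case (run_instr n c r c' i)
  have "1 < tapes M" using assms by (simp add: wf_otm_def)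
  then show ?case using run_instr abs_shift[of "moves i ! 1"] by (auto simp: exec_def)
next
  case (run_query n c r c' b)
  then show ?case using length_query_string[of n c'] by auto
qed

text \<open>Cell \<open>s\<close> itself may be written, so a query can have length
  \<open>s + 1\<close>.\<close>

lemma run_space_invariant:
  assumes "wf_otm M" and K: "\<And>c. K c \<Longrightarrow> \<bar>head c 1\<bar> \<le> int s"
  shows "run M K n c r c' \<Longrightarrow> c = init M x \<Longrightarrow>
    \<bar>head c' 1\<bar> \<le> int s \<and> (\<forall>p>int s. tape c' 1 p = 0) \<and> (\<forall>(q, b)\<in>set r. length q \<le> s + 1)"
proof (induction rule: run.induct)
  case (run_0 c)
  then show ?case by (simp add: init_def)
next
  case (run_instr n c r c' i)
  have "1 < tapes M" using assms by (simp add: wf_otm_def)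
  then show ?case using run_instr K[OF \<open>K (exec M i c')\<close>] by (auto simp: exec_def)
next
  case (run_query n c r c' b)
  then show ?case using length_query_string[of "s + 1" c'] by auto
qed

section \<open>Relativized classes as operators on oracles\<close>

text \<open>Acceptance is cut off at the bound instead of requiring that the machine obeys it, so
  the operator makes sense for oracles with which \<open>M\<close> runs too long.\<close>

definition clocked :: "otm \<Rightarrow> nat poly \<Rightarrow> bool list set \<Rightarrow> bool list set" where
  "clocked M p B = {x. \<exists>n\<le>poly p (length x). \<exists>c. (step M B ^^ n) (init M x) c \<and> state c = accept M}"

definition spaced :: "otm \<Rightarrow> nat poly \<Rightarrow> bool list set \<Rightarrow> bool list set" where
  "spaced M p B = {x. \<exists>c. (\<lambda>c c'. step M B c c' \<and> (\<forall>i<tapes M. \<bar>head c' i\<bar> \<le> int (poly p (length x))))\<^sup>*\<^sup>* (init M x) c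
     \<and> state c = accept M}"

definition hierarchy :: "(otm \<times> nat poly) list \<Rightarrow> bool list set \<Rightarrow> bool list set" where
  "hierarchy cs = foldr (\<lambda>(M, p). clocked M p) cs"

lemma hierarchy_simps [simp]:
  "hierarchy [] B = B" "hierarchy ((M, p) # cs) B = clocked M p (hierarchy cs B)"
  by (simp_all add: hierarchy_def)

lemma clocked_iff_run:
  "x \<in> clocked M p B \<longleftrightarrow> (\<exists>r\<in>{r. \<exists>n\<le>poly p (length x). \<exists>c. run M (\<lambda>_. True) n (init M x) r c \<and> state c = accept M}.
     agrees B r)"
  using run_imp_relpowp[where K = "\<lambda>_. True" and M = M and B = B and c = "init M x"]
    relpowp_imp_run[where K = "\<lambda>_. True" and M = M and B = B and c = "init M x"]
  unfolding clocked_def by simp blast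

text \<open>The accepting runs with guessed answers do not depend on the oracle. Their transcripts
  are the terms of a disjunctive normal form in the queries; a transcript with contradictory answers
  agrees with no oracle and does no harm. There are finitely many because number and length of the
  queries are bounded.\<close>

lemma clocked_dnf:
  assumes "wf_otm M"
  shows "\<exists>R. finite R \<and> (\<forall>B. x \<in> clocked M p B \<longleftrightarrow> (\<exists>r\<in>R. agrees B r)) \<and>
    (\<forall>r\<in>R. length r \<le> poly p (length x) \<and> (\<forall>(q, b)\<in>set r. length q \<le> poly p (length x)))"
proof -
  let ?t = "poly p (length x)"
  define R where "R = {r. \<exists>n\<le>?t. \<exists>c. run M (\<lambda>_. True) n (init M x) r c \<and> state c = accept M}"
  have R: "length r \<le> ?t \<and> (\<forall>(q, b)\<in>set r. length q \<le> ?t)" if r: "r \<in> R" for r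
  proof -
    obtain n c where n: "n \<le> ?t" and run: "run M (\<lambda>_. True) n (init M x) r c"
      using r unfolding R_def by blast
    have "\<forall>(q, b)\<in>set r. length q \<le> n" using run_time_invariant[OF assms run] by blast
    then show ?thesis using n run_length[OF run] by fastforce
  qed
  then have "R \<subseteq> {r. set r \<subseteq> {q. length q \<le> ?t} \<times> UNIV \<and> length r \<le> ?t}" by fastforce
  then have "finite R"
    by (rule finite_subset) (intro finite_lists_length_le finite_SigmaI finite_strings_le finite)
  moreover have "\<forall>B. x \<in> clocked M p B \<longleftrightarrow> (\<exists>r\<in>R. agrees B r)"
    unfolding clocked_iff_run R_def by blast
  ultimately show ?thesis using R by blast
qed

text \<open>A polynomial modulus of continuity, uniform in the oracle.\<close>

definition local_op :: "(bool list set \<Rightarrow> bool list set) \<Rightarrow> nat poly \<Rightarrow> bool" where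
  "local_op F q \<longleftrightarrow> (\<forall>x B B'. (\<forall>w. length w \<le> poly q (length x) \<longrightarrow> (w \<in> B) = (w \<in> B')) \<longrightarrow>
     (x \<in> F B) = (x \<in> F B'))"

lemma local_opD:
  "local_op F q \<Longrightarrow> (\<And>w. length w \<le> poly q (length x) \<Longrightarrow> (w \<in> B) = (w \<in> B')) \<Longrightarrow>
    (x \<in> F B) = (x \<in> F B')"
  unfolding local_op_def by blast

lemma local_clocked:
  assumes "wf_otm M"
  shows "local_op (clocked M p) p"
  unfolding local_op_def
proof (intro allI impI)
  fix x :: "bool list" and B B' :: "bool list set" assume eq: "\<forall>w. length w \<le> poly p (length x) \<longrightarrow> (w \<in> B) = (w \<in> B')"
  obtain R where R: "\<forall>B. x \<in> clocked M p B \<longleftrightarrow> (\<exists>r\<in>R. agrees B r)"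
    "\<forall>r\<in>R. length r \<le> poly p (length x) \<and> (\<forall>(q, b)\<in>set r. length q \<le> poly p (length x))"
    using clocked_dnf[OF assms, of x p] by (elim exE conjE)
  have "agrees B r \<longleftrightarrow> agrees B' r" if "r \<in> R" for r
    unfolding agrees_def using R(2) that eq by (intro ball_cong refl) fastforce
  then show "(x \<in> clocked M p B) = (x \<in> clocked M p B')" using R(1) by simp
qed

lemma local_hierarchy:
  assumes "\<forall>(M, p)\<in>set cs. wf_otm M"
  shows "\<exists>q. local_op (hierarchy cs) q"
  using assms
proof (induction cs)
  case Nil
  show ?case by (rule exI[of _ "[:0, 1:]"]) (simp add: local_op_def)
next
  case (Cons Mp cs)
  obtain M p where Mp: "Mp = (M, p)" by (cases Mp)
  obtain q where q: "local_op (hierarchy cs) q" using Cons by auto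
  have "local_op (hierarchy (Mp # cs)) (pcompose q p)"
    unfolding local_op_def
  proof (intro allI impI)
    fix x :: "bool list" and B B' :: "bool list set" assume eq: "\<forall>w. length w \<le> poly (pcompose q p) (length x) \<longrightarrow> (w \<in> B) = (w \<in> B')"
    have "(y \<in> hierarchy cs B) = (y \<in> hierarchy cs B')" if "length y \<le> poly p (length x)" for y
      using eq poly_nat_mono[OF that, of q]
      by (intro local_opD[OF q]) (auto simp: poly_pcompose)
    then show "(x \<in> hierarchy (Mp # cs) B) = (x \<in> hierarchy (Mp # cs) B')"
      using Cons.prems unfolding Mp hierarchy_simps by (intro local_opD[OF local_clocked]) auto
  qed
  then show ?case ..
qed

text \<open>A space-bounded run may make exponentially many queries, so it has no small normal form;
  but locality concerns only their length, which the head bound controls.\<close>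

lemma local_spaced:
  assumes M: "wf_otm M"
  shows "local_op (spaced M p) (p + 1)"
  unfolding local_op_def
proof (intro allI impI)
  fix x :: "bool list" and B B' :: "bool list set" assume eq: "\<forall>w. length w \<le> poly (p + 1) (length x) \<longrightarrow> (w \<in> B) = (w \<in> B')"
  let ?K = "\<lambda>c. \<forall>i<tapes M. \<bar>head c i\<bar> \<le> int (poly p (length x))"
  have K: "\<bar>head c 1\<bar> \<le> int (poly p (length x))" if "?K c" for c
    using that M by (simp add: wf_otm_def)
  have "x \<in> spaced M p B'" if x: "x \<in> spaced M p B"
    and eq: "\<forall>w. length w \<le> poly (p + 1) (length x) \<longrightarrow> (w \<in> B) = (w \<in> B')" for B B' :: "bool list set"
  proof -
    obtain n c where c: "((\<lambda>c c'. step M B c c' \<and> ?K c') ^^ n) (init M x) c" "state c = accept M"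
      using x unfolding spaced_def by (auto dest: rtranclp_imp_relpowp)
    obtain r where r: "run M ?K n (init M x) r c" "agrees B r" using relpowp_imp_run[OF c(1)] by blast
    have "\<forall>(q, b)\<in>set r. length q \<le> poly p (length x) + 1"
      using run_space_invariant[OF M K r(1)] by blast
    then have "agrees B' r" using r(2) eq unfolding agrees_def by fastforce
    then have "((\<lambda>c c'. step M B' c c' \<and> ?K c') ^^ n) (init M x) c" by (rule run_imp_relpowp[OF r(1)])
    then show ?thesis unfolding spaced_def using c(2) by (auto dest: relpowp_imp_rtranclp)
  qed
  then show "(x \<in> spaced M p B) = (x \<in> spaced M p B')" using eq by metis
qed

lemma accepts_eq_clocked:
  assumes "\<forall>x. time_bounded M B x (poly p (length x))"
  shows "{x. accepts M B x} = clocked M p B"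
  using assms unfolding accepts_def clocked_def time_bounded_def rtranclp_power by blast

lemma Sigma_class_hierarchy:
  assumes "L \<in> Sigma_class k B"
  shows "\<exists>cs. (\<forall>(M, p)\<in>set cs. wf_otm M) \<and> L = hierarchy cs B"
  using assms
proof (induction k arbitrary: L)
  case 0
  then obtain M p where "wf_otm M" "L = clocked M p B"
    by (auto simp: P_class_def accepts_eq_clocked)
  then show ?case by (intro exI[of _ "[(M, p)]"]) simp
next
  case (Suc k)
  then obtain C M p where "C \<in> Sigma_class k B" "wf_otm M" "L = clocked M p C"
    by (auto simp: NP_class_def accepts_eq_clocked)
  then obtain cs where "\<forall>(M, p)\<in>set cs. wf_otm M" "C = hierarchy cs B" using Suc.IH by blast
  then show ?case using \<open>wf_otm M\<close> \<open>L = _\<close> by (intro exI[of _ "(M, p) # cs"]) auto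
qed

lemma PSPACE_spaced:
  assumes "L \<in> PSPACE B"
  shows "\<exists>M p. wf_otm M \<and> L = spaced M p B"
proof -
  obtain M p where M: "wf_otm M" "\<forall>x. space_bounded M B x (poly p (length x))" "L = {x. accepts M B x}"
    using assms unfolding PSPACE_def by blast
  have "(\<lambda>c c'. step M B c c' \<and> (\<forall>i<tapes M. \<bar>head c' i\<bar> \<le> int (poly p (length x))))\<^sup>*\<^sup>* (init M x) c"
    if "(step M B)\<^sup>*\<^sup>* (init M x) c" for x c
    using that
  proof (induction rule: rtranclp_induct)
    case (step y z)
    then have "(step M B)\<^sup>*\<^sup>* (init M x) z" by simp
    then have "\<forall>i<tapes M. \<bar>head z i\<bar> \<le> int (poly p (length x))"
      using M(2) unfolding space_bounded_def by blast
    then show ?case using step by (auto intro: rtranclp.rtrancl_into_rtrancl)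
  qed simp
  moreover have "(step M B)\<^sup>*\<^sup>* (init M x) c"
    if "(\<lambda>c c'. step M B c c' \<and> (\<forall>i<tapes M. \<bar>head c' i\<bar> \<le> int (poly p (length x))))\<^sup>*\<^sup>* (init M x) c" for x c
    using that by (rule rtranclp_mono[THEN predicate2D, rotated]) auto
  ultimately have "L = spaced M p B" unfolding M(3) accepts_def spaced_def by blast
  then show ?thesis using M(1) by blast
qed

section \<open>Approximating the levels of the hierarchy\<close>

lemma pow_add_pow_le: "(2::nat) ^ a + 2 ^ b \<le> 2 ^ (a + b + 1)"
proof -
  have "(2::nat) ^ a \<le> 2 ^ (a + b)" "(2::nat) ^ b \<le> 2 ^ (a + b)"
    by (rule power_increasing; simp)+
  moreover have "(2::nat) ^ (a + b + 1) = 2 ^ (a + b) + 2 ^ (a + b)" by simp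
  ultimately show ?thesis by linarith
qed

lemma card_strings_le: "card {q :: bool list. length q \<le> n} \<le> 2 ^ (n + 1)"
proof -
  have "card {q :: bool list. length q \<le> n} = (\<Sum>i\<le>n. 2 ^ i)"
    using card_lists_length_le[of "UNIV :: bool set" n] by simp
  also have "\<dots> \<le> 2 ^ (n + 1)" by (induction n) auto
  finally show ?thesis .
qed

text \<open>The degree bound is polynomial in \<open>m\<close> and \<open>l\<close>, while the fraction \<open>2 ^ poly q m / 2 ^ l\<close> of bad inputs,
  common to all strings \<open>y\<close> of length at most \<open>m\<close>, can still be made small by choosing \<open>l\<close>.\<close>

definition approximable :: "(bool list set \<Rightarrow> bool list set) \<Rightarrow> nat \<Rightarrow> nat poly \<Rightarrow> nat poly \<Rightarrow> bool" where
  "approximable F k d q \<longleftrightarrow> (\<forall>V D m l. finite V \<longrightarrow> (\<exists>E P. E \<subseteq> Pow V \<and>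
    2 ^ l * card E \<le> 2 ^ (poly q m) * 2 ^ card V \<and>
    (\<forall>y. length y \<le> m \<longrightarrow>
      P y \<in> deg V (l ^ k * poly d m) \<and> (\<forall>X\<in>Pow V - E. P y X = of_bool (y \<in> F (D \<union> X))))))"

lemma approximable_id: "approximable (\<lambda>B. B) 0 1 0"
  unfolding approximable_def
proof (intro allI impI)
  fix V D :: "bool list set" and m l :: nat
  assume V: "finite V"
  let ?P = "\<lambda>y X. if y \<in> D \<or> y \<notin> V then of_bool (y \<in> D) else of_bool (y \<in> X) :: 3"
  have "?P y \<in> deg V 1" for y
    using V by (cases "y \<in> D \<or> y \<notin> V") (auto intro!: deg_const deg_variable simp del: One_nat_def)
  moreover have "?P y X = of_bool (y \<in> D \<union> X)" if "X \<in> Pow V" for y X using that by auto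
  ultimately show "\<exists>E P. E \<subseteq> Pow V \<and> 2 ^ l * card E \<le> 2 ^ (poly 0 m) * 2 ^ card V \<and>
    (\<forall>y. length y \<le> m \<longrightarrow> P y \<in> deg V (l ^ 0 * poly 1 m) \<and>
      (\<forall>X\<in>Pow V - E. P y X = of_bool (y \<in> D \<union> X)))"
    by (intro exI[of _ "{}"] exI[of _ ?P]) simp
qed

text \<open>One disjunction per string \<open>y\<close>: a level multiplies the degree by
  \<open>2 * l * poly p m\<close>. The lower level is approximated once for all queries of length up
  to \<open>poly p m\<close>, and a union bound over at most \<open>2 ^ (m + 1)\<close> strings
  collects the new error sets. The sum of the two shares costs one more factor 2, hence
  \<open>[:2, 1:]\<close>.\<close>

lemma approximable_clocked:
  assumes M: "wf_otm M" and F: "approximable F k d q"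
  shows "approximable (\<lambda>B. clocked M p (F B)) (Suc k) ([:2:] * p * pcompose d p) (pcompose q p + [:2, 1:])"
  unfolding approximable_def
proof (intro allI impI)
  fix V D :: "bool list set" and m l :: nat
  assume V: "finite V"
  let ?d = "[:2:] * p * pcompose d p" and ?q = "pcompose q p + [:2, 1:]"
  let ?t = "poly p m" and ?Y = "{y :: bool list. length y \<le> m}"
  let ?e = "l * (2 * (?t * (l ^ k * poly d ?t)))"
  obtain E P where E: "E \<subseteq> Pow V" "2 ^ l * card E \<le> 2 ^ (poly q ?t) * 2 ^ card V"
    and P: "\<forall>y. length y \<le> ?t \<longrightarrow> P y \<in> deg V (l ^ k * poly d ?t) \<and>
      (\<forall>X\<in>Pow V - E. P y X = of_bool (y \<in> F (D \<union> X)))"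
    using F[unfolded approximable_def, rule_format, OF V, of l ?t D] by (elim exE conjE)
  define Q where "Q y g F' \<longleftrightarrow> g \<in> deg V ?e \<and> F' \<subseteq> Pow V \<and> 2 ^ l * card F' \<le> 2 ^ card V \<and>
    (\<forall>X\<in>Pow V - (E \<union> F'). g X = of_bool (y \<in> clocked M p (F (D \<union> X))))" for y g F'
  have "\<exists>g F'. Q y g F'" if y: "y \<in> ?Y" for y
  proof -
    obtain R where R: "finite R" "\<forall>B. y \<in> clocked M p B \<longleftrightarrow> (\<exists>r\<in>R. agrees B r)"
      "\<forall>r\<in>R. length r \<le> poly p (length y) \<and> (\<forall>(q, b)\<in>set r. length q \<le> poly p (length y))"
      using clocked_dnf[OF M, of y p] by (elim exE conjE)
    have le: "poly p (length y) \<le> ?t" using y by (intro poly_nat_mono) simp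
    have lits: "length r \<le> ?t \<and> fst ` set r \<subseteq> {q. length q \<le> ?t}" if "r \<in> R" for r
      using R(3) that le by fastforce
    have "\<exists>g\<in>deg V ?e. \<exists>F'\<subseteq>Pow V. 2 ^ l * card F' \<le> 2 ^ card V \<and>
      (\<forall>X\<in>Pow V - (E \<union> F'). g X = of_bool (\<exists>r\<in>R. agrees (F (D \<union> X)) r))"
      unfolding agrees_def by (rule dnf_approx[OF V R(1) lits, where P = P and h = "\<lambda>y X. y \<in> F (D \<union> X)"])
         (use P in \<open>simp_all only: mem_Collect_eq\<close>)
    then have "\<exists>g. g \<in> deg V ?e \<and> (\<exists>F'. F' \<subseteq> Pow V \<and> 2 ^ l * card F' \<le> 2 ^ card V \<and>
      (\<forall>X\<in>Pow V - (E \<union> F'). g X = of_bool (y \<in> clocked M p (F (D \<union> X)))))"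
      by (simp only: R(2) Bex_def)
    then show ?thesis unfolding Q_def by (elim exE conjE) (intro exI conjI)
  qed
  then obtain g F' where gF: "\<And>y. y \<in> ?Y \<Longrightarrow> Q y (g y) (F' y)" by metis
  have degree: "l ^ Suc k * poly ?d m = ?e" by (simp add: poly_pcompose mult_ac)
  have qm: "poly ?q m = poly q ?t + (m + 1) + 1" by (simp add: poly_pcompose)
  have F': "F' y \<subseteq> Pow V" "2 ^ l * card (F' y) \<le> 2 ^ card V" if "y \<in> ?Y" for y
    using gF[OF that] unfolding Q_def by blast+
  let ?E = "E \<union> (\<Union>y\<in>?Y. F' y)"
  have E_sub: "?E \<subseteq> Pow V" using E(1) F'(1) by blast
  have "card ?E \<le> card E + (\<Sum>y\<in>?Y. card (F' y))"
    by (rule order_trans[OF card_Un_le]) (intro add_left_mono card_UN_le finite_strings_le)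
  then have "2 ^ l * card ?E \<le> 2 ^ l * (card E + (\<Sum>y\<in>?Y. card (F' y)))"
    by (rule mult_le_mono2)
  also have "\<dots> = 2 ^ l * card E + (\<Sum>y\<in>?Y. 2 ^ l * card (F' y))"
    by (simp only: distrib_left sum_distrib_left)
  also have "\<dots> \<le> 2 ^ (poly q ?t) * 2 ^ card V + (\<Sum>y\<in>?Y. 2 ^ card V)"
    by (intro add_mono E(2) sum_mono F'(2))
  also have "\<dots> \<le> 2 ^ (poly q ?t) * 2 ^ card V + 2 ^ (m + 1) * 2 ^ card V"
    unfolding sum_constant of_nat_id by (intro add_left_mono mult_le_mono1 card_strings_le)
  also have "\<dots> \<le> 2 ^ (poly q ?t + (m + 1) + 1) * 2 ^ card V"
    unfolding distrib_right[symmetric] by (intro mult_le_mono1 pow_add_pow_le)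
  finally have E_card: "2 ^ l * card ?E \<le> 2 ^ (poly q ?t + (m + 1) + 1) * 2 ^ card V" .
  have "g y \<in> deg V ?e \<and> (\<forall>X\<in>Pow V - ?E. g y X = of_bool (y \<in> clocked M p (F (D \<union> X))))"
    if "length y \<le> m" for y
    using gF[of y] that unfolding Q_def by blast
  then show "\<exists>E P. E \<subseteq> Pow V \<and> 2 ^ l * card E \<le> 2 ^ (poly ?q m) * 2 ^ card V \<and>
    (\<forall>y. length y \<le> m \<longrightarrow> P y \<in> deg V (l ^ Suc k * poly ?d m) \<and>
      (\<forall>X\<in>Pow V - E. P y X = of_bool (y \<in> clocked M p (F (D \<union> X)))))"
    unfolding degree qm using E_sub E_card by (intro exI[of _ ?E] exI[of _ g]) simp
qed

lemma approximable_hierarchy: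
  "\<forall>(M, p)\<in>set cs. wf_otm M \<Longrightarrow> \<exists>k d q. approximable (hierarchy cs) k d q"
proof (induction cs)
  case Nil
  have "hierarchy [] = (\<lambda>B. B)" by auto
  then show ?case using approximable_id by auto
next
  case (Cons Mp cs)
  obtain M p where Mp: "Mp = (M, p)" by (cases Mp)
  have "hierarchy (Mp # cs) = (\<lambda>B. clocked M p (hierarchy cs B))" using Mp by auto
  moreover have "wf_otm M" "\<forall>(M, p)\<in>set cs. wf_otm M" using Cons.prems Mp by auto
  ultimately show ?case using approximable_clocked Cons.IH by metis
qed

section \<open>Deterministic runs and configurations with two tapes\<close>

lemma step_functional: "deterministic M \<Longrightarrow> right_unique (step M B)"
  by (rule right_uniqueI) (auto elim!: step.cases simp: deterministic_def)

lemma relpowp_functional: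
  fixes R :: "'a \<Rightarrow> 'a \<Rightarrow> bool"
  shows "right_unique R \<Longrightarrow> (R ^^ n) c d \<Longrightarrow> (R ^^ n) c e \<Longrightarrow> d = e"
  using relpowp_right_unique[where R = R and n = n and x = c and y = d and z = e] by (blast dest: right_uniqueD)

lemma relpowp_le_halting:
  fixes R :: "'a \<Rightarrow> 'a \<Rightarrow> bool"
  assumes fn: "right_unique R"
    and T: "(R ^^ T) c d" and halt: "\<nexists>d'. R d d'" and n: "(R ^^ n) c e"
  shows "n \<le> T"
proof (rule ccontr)
  assume "\<not> n \<le> T"
  then obtain k where k: "n = T + Suc k" using less_imp_Suc_add[of T n] by auto
  obtain e' where "(R ^^ T) c e'" "(R ^^ Suc k) e' e" using n unfolding k relpowp_add by auto
  then have "(R ^^ Suc k) d e" using relpowp_functional[OF fn] T by metis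
  then show False using halt relpowp_Suc_D2 by metis
qed

lemma accepting_halts:
  assumes "wf_otm M" "state c = accept M"
  shows "\<not> step M B c c'"
  using assms by (auto elim!: step.cases simp: wf_otm_def)

lemma deterministic_run:
  assumes M: "wf_otm M" "deterministic M"
    and T: "(step M B ^^ T) (init M x) c" and halt: "\<nexists>c'. step M B c c'"
  shows "time_bounded M B x T" "accepts M B x \<longleftrightarrow> state c = accept M"
proof -
  note fn = step_functional[OF M(2), of B]
  have le: "n \<le> T" if "(step M B ^^ n) (init M x) d" for n d
    using relpowp_le_halting[OF fn T halt that] .
  then show "time_bounded M B x T" unfolding time_bounded_def by blast
  show "accepts M B x \<longleftrightarrow> state c = accept M"
  proof
    assume "accepts M B x"
    then obtain n d where d: "(step M B ^^ n) (init M x) d" "state d = accept M"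
      unfolding accepts_def by (auto dest: rtranclp_imp_relpowp)
    have "T \<le> n"
      using relpowp_le_halting[OF fn d(1) _ T] accepting_halts[OF M(1) d(2)] by blast
    then have "n = T" using le[OF d(1)] by simp
    then show "state c = accept M" using relpowp_functional[OF fn T] d by blast
  next
    assume "state c = accept M"
    then show "accepts M B x" unfolding accepts_def using T by (auto dest: relpowp_imp_rtranclp)
  qed
qed

definition tape_of :: "bool list \<Rightarrow> int \<Rightarrow> nat" where
  "tape_of w p = (if 0 \<le> p \<and> nat p < length w then bit_symbol (w ! nat p) else 0)"

text \<open>Tapes and heads from index 2 on keep their initial values; configurations are total
  functions, so this is needed for them to be equal.\<close>

definition cfg :: "nat \<Rightarrow> (int \<Rightarrow> nat) \<Rightarrow> (int \<Rightarrow> nat) \<Rightarrow> int \<Rightarrow> int \<Rightarrow> config" where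
  "cfg q t0 t1 h0 h1 = Config q (\<lambda>i. if i = 0 then t0 else if i = 1 then t1 else (\<lambda>_. 0))
     (\<lambda>i. if i = 0 then h0 else if i = 1 then h1 else 0)"

lemma state_cfg [simp]: "state (cfg q t0 t1 h0 h1) = q"
  and head_cfg [simp]: "head (cfg q t0 t1 h0 h1) 0 = h0" "head (cfg q t0 t1 h0 h1) (Suc 0) = h1"
  by (simp_all add: cfg_def)

lemma init_cfg: "init M x = cfg (start M) (tape_of x) (tape_of []) 0 0"
  by (auto simp: init_def cfg_def tape_of_def fun_eq_iff)

lemma scanned_cfg: "tapes M = 2 \<Longrightarrow> scanned M (cfg q t0 t1 h0 h1) = [t0 h0, t1 h1]"
  by (simp add: scanned_def cfg_def upt_rec)

lemma step_cfg:
  assumes "Instr q [a, b] q' [a', b'] [u, v] \<in> set (program M)" "tapes M = 2" "q \<noteq> query M"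
    and "t0 h0 = a" "t1 h1 = b"
  shows "step M B (cfg q t0 t1 h0 h1) (cfg q' (t0(h0 := a')) (t1(h1 := b')) (h0 + shift u) (h1 + shift v))"
proof -
  let ?i = "Instr q [a, b] q' [a', b'] [u, v]"
  have "step M B (cfg q t0 t1 h0 h1) (exec M ?i (cfg q t0 t1 h0 h1))"
    using assms by (intro step_instr) (simp_all add: scanned_cfg)
  moreover have "exec M ?i (cfg q t0 t1 h0 h1) = cfg q' (t0(h0 := a')) (t1(h1 := b')) (h0 + shift u) (h1 + shift v)"
    using assms by (auto simp: exec_def cfg_def fun_eq_iff less_2_cases_iff)
  ultimately show ?thesis by simp
qed

lemma tape_of_range: "tape_of w p \<in> range bit_symbol \<longleftrightarrow> 0 \<le> p \<and> nat p < length w"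
  by (auto simp: tape_of_def bit_symbol_def)

lemma query_string_cfg [simp]: "query_string (cfg q t0 (tape_of w) h0 h1) = w"
proof -
  have "(LEAST n. tape_of w (int n) \<notin> range bit_symbol) = length w"
    by (rule Least_equality) (auto simp: tape_of_range not_less)
  then have "query_string (cfg q t0 (tape_of w) h0 h1) =
      map (\<lambda>p. tape_of w (int p) = bit_symbol True) [0..<length w]"
    by (simp add: query_string_def cfg_def)
  also have "\<dots> = map (\<lambda>p. w ! p) [0..<length w]"
    by (intro map_cong refl) (auto simp: tape_of_def bit_symbol_def)
  finally show ?thesis by (simp add: map_nth)
qed

lemma step_query_cfg:
  assumes "q = query M" "q' = (if w \<in> B then yes M else no M)"
  shows "step M B (cfg q t0 (tape_of w) h0 h1) (cfg q' t0 (tape_of w) h0 h1)"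
proof -
  let ?c = "cfg q t0 (tape_of w) h0 h1"
  have "step M B ?c (Config (if query_string ?c \<in> B then yes M else no M) (tape ?c) (head ?c))"
    using assms by (intro step_query) simp
  moreover have "Config (if query_string ?c \<in> B then yes M else no M) (tape ?c) (head ?c) =
      cfg q' t0 (tape_of w) h0 h1"
    unfolding query_string_cfg assms(2) by (simp add: cfg_def)
  ultimately show ?thesis by simp
qed

lemma tape_of_blank [simp]: "tape_of w (int (length w)) = 0"
  by (simp add: tape_of_def)

lemma tape_of_nth: "n < length w \<Longrightarrow> tape_of w (int n) = bit_symbol (w ! n)"
  by (simp add: tape_of_def)

lemma tape_of_append: "(tape_of w)(int (length w) := bit_symbol b) = tape_of (w @ [b])"
  by (auto simp: tape_of_def fun_eq_iff nth_append)

lemma bit_symbol_simps [simp]: "bit_symbol True = 2" "bit_symbol False = 1"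
  by (simp_all add: bit_symbol_def)

lemma tape_of_symbols: "tape_of w p \<in> {0, 1, 2}"
  by (simp add: tape_of_def bit_symbol_def)

section \<open>An oracle with \<open>PH = PSPACE\<close>\<close>

text \<open>The machine writes \<open>m\<close> in unary, a separator, the input and another separator on the query tape. Then it
  appends padding bits \<open>True\<close> until the oracle says yes, appends \<open>False\<close> and accepts if the oracle says
  yes again. Symbol 1 behind the input on tape 0 marks the second phase.\<close>

definition pad_otm :: "nat \<Rightarrow> otm" where
  "pad_otm m = OTM 2 0 (m + 2) (m + 3) (m + 4) (m + 5)
    (map (\<lambda>(i, a). Instr i [a, 0] (i + 1) [a, 2] [Stay, Right]) (List.product [0..<m] [0, 1, 2]) @
     map (\<lambda>a. Instr m [a, 0] (m + 1) [a, 1] [Stay, Right]) [0, 1, 2] @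
     map (\<lambda>a. Instr (m + 1) [a, 0] (m + 1) [a, a] [Right, Right]) [1, 2] @
     [Instr (m + 1) [0, 0] (m + 5) [0, 1] [Stay, Right],
      Instr (m + 5) [0, 0] (m + 3) [0, 2] [Stay, Right],
      Instr (m + 4) [0, 0] (m + 3) [1, 1] [Stay, Right],
      Instr (m + 4) [1, 0] (m + 2) [1, 0] [Stay, Stay]])"

lemma pad_otm_simps [simp]:
  "tapes (pad_otm m) = 2" "start (pad_otm m) = 0" "accept (pad_otm m) = m + 2"
  "query (pad_otm m) = m + 3" "yes (pad_otm m) = m + 4" "no (pad_otm m) = m + 5"
  by (simp_all add: pad_otm_def)

lemma program_pad_otm:
  "set (program (pad_otm m)) =
    (\<lambda>(i, a). Instr i [a, 0] (i + 1) [a, 2] [Stay, Right]) ` ({0..<m} \<times> {0, 1, 2}) \<union>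
    ((\<lambda>a. Instr m [a, 0] (m + 1) [a, 1] [Stay, Right]) ` {0, 1, 2} \<union>
    ((\<lambda>a. Instr (m + 1) [a, 0] (m + 1) [a, a] [Right, Right]) ` {1, 2} \<union>
    {Instr (m + 1) [0, 0] (m + 5) [0, 1] [Stay, Right],
      Instr (m + 5) [0, 0] (m + 3) [0, 2] [Stay, Right],
      Instr (m + 4) [0, 0] (m + 3) [1, 1] [Stay, Right],
      Instr (m + 4) [1, 0] (m + 2) [1, 0] [Stay, Stay]}))"
  unfolding pad_otm_def otm.sel set_append set_map set_product set_upt list.set ..

lemma wf_pad_otm: "wf_otm (pad_otm m)"
  unfolding wf_otm_def program_pad_otm ball_Un by simp

lemma deterministic_pad_otm: "deterministic (pad_otm m)"
  unfolding deterministic_def program_pad_otm ball_Un by auto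

definition pad_prefix :: "nat \<Rightarrow> bool list \<Rightarrow> bool list" where
  "pad_prefix m x = replicate m True @ False # x @ [False]"

definition pad :: "nat \<Rightarrow> bool list \<Rightarrow> nat \<Rightarrow> bool list" where
  "pad m x s = pad_prefix m x @ replicate s True"

abbreviation pcfg :: "nat \<Rightarrow> (int \<Rightarrow> nat) \<Rightarrow> int \<Rightarrow> bool list \<Rightarrow> config" where
  "pcfg q t h w \<equiv> cfg q t (tape_of w) h (int (length w))"

lemma step_append:
  assumes "Instr q [a, 0] q' [a', bit_symbol b] [u, Right] \<in> set (program M)" "tapes M = 2" "q \<noteq> query M"
    and "t h = a"
  shows "step M B (pcfg q t h w) (pcfg q' (t(h := a')) (h + shift u) (w @ [b]))"
  using step_cfg[OF assms(1-3), of t h "tape_of w" "int (length w)" B] assms(4)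
  by (simp add: tape_of_append add.commute)

lemma step_append_same:
  assumes "Instr q [a, 0] q' [a, bit_symbol b] [u, Right] \<in> set (program M)" "tapes M = 2" "q \<noteq> query M"
    and "t h = a"
  shows "step M B (pcfg q t h w) (pcfg q' t (h + shift u) (w @ [b]))"
  using step_append[OF assms(1-3), of t h B w] assms(4) by (simp add: fun_upd_idem)

lemma pad_write_index:
  "i \<le> m \<Longrightarrow> (step (pad_otm m) B ^^ i) (pcfg 0 (tape_of x) 0 []) (pcfg i (tape_of x) 0 (replicate i True))"
proof (induction i)
  case (Suc i)
  have "step (pad_otm m) B (pcfg i (tape_of x) 0 (replicate i True))
      (pcfg (i + 1) (tape_of x) (0 + shift Stay) (replicate i True @ [True]))"
    using Suc.prems tape_of_symbols[of x 0]
    by (intro step_append_same[where a = "tape_of x 0"]) (auto simp: program_pad_otm)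
  then show ?case using Suc by (auto simp: replicate_append_same intro: relpowp_Suc_I)
qed simp

lemma pad_copy_input:
  "j \<le> length x \<Longrightarrow> (step (pad_otm m) B ^^ j) (pcfg (m + 1) (tape_of x) 0 w)
     (pcfg (m + 1) (tape_of x) (int j) (w @ take j x))"
proof (induction j)
  case (Suc j)
  have "step (pad_otm m) B (pcfg (m + 1) (tape_of x) (int j) (w @ take j x))
      (pcfg (m + 1) (tape_of x) (int j + shift Right) ((w @ take j x) @ [x ! j]))"
    using Suc.prems by (intro step_append_same[where a = "bit_symbol (x ! j)"])
      (auto simp: program_pad_otm bit_symbol_def tape_of_nth)
  then show ?case using Suc by (auto simp: take_Suc_conv_app_nth add.commute intro: relpowp_Suc_I)
qed simp

lemma steps_snoc: "(step M B ^^ n) c d \<Longrightarrow> step M B d e \<Longrightarrow> (step M B ^^ (n + 1)) c e"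
  by auto

lemma pad_write_prefix:
  "(step (pad_otm m) B ^^ (m + 1 + length x + 1)) (init (pad_otm m) x)
     (pcfg (m + 5) (tape_of x) (int (length x)) (pad m x 0))"
proof -
  let ?s = "step (pad_otm m) B" and ?u = "replicate m True @ [False]"
  have 1: "(?s ^^ m) (init (pad_otm m) x) (pcfg m (tape_of x) 0 (replicate m True))"
    using pad_write_index[of m m B x] by (simp add: init_cfg)
  have 2: "?s (pcfg m (tape_of x) 0 (replicate m True)) (pcfg (m + 1) (tape_of x) (0 + shift Stay) ?u)"
    using tape_of_symbols[of x 0]
    by (intro step_append_same[where a = "tape_of x 0"]) (auto simp: program_pad_otm)
  have 3: "(?s ^^ length x) (pcfg (m + 1) (tape_of x) (0 + shift Stay) ?u)
      (pcfg (m + 1) (tape_of x) (int (length x)) (?u @ take (length x) x))"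
    using pad_copy_input[of "length x" x m B ?u] by (simp only: shift.simps add_0_left order_refl simp_thms)
  have 4: "?s (pcfg (m + 1) (tape_of x) (int (length x)) (?u @ take (length x) x))
      (pcfg (m + 5) (tape_of x) (int (length x) + shift Stay) ((?u @ take (length x) x) @ [False]))"
    by (intro step_append_same[where a = 0]) (auto simp: program_pad_otm)
  have "(?u @ take (length x) x) @ [False] = pad m x 0" by (simp add: pad_def pad_prefix_def)
  then show ?thesis
    using steps_snoc[OF relpowp_trans[OF steps_snoc[OF 1 2] 3] 4] by (simp only: shift.simps add_0_right)
qed

text \<open>State \<open>m + 5\<close> is both the entry of the loop and the \<open>no\<close>
  state, so a negative answer repeats the loop.\<close>

lemma pad_extend:
  assumes "q' = (if pad m x (Suc s) \<in> B then m + 4 else m + 5)"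
  shows "(step (pad_otm m) B ^^ 2) (pcfg (m + 5) (tape_of x) (int (length x)) (pad m x s))
     (pcfg q' (tape_of x) (int (length x)) (pad m x (Suc s)))"
proof -
  let ?h = "int (length x)"
  have e: "pad m x s @ [True] = pad m x (Suc s)" by (simp add: pad_def replicate_append_same)
  have "step (pad_otm m) B (pcfg (m + 5) (tape_of x) ?h (pad m x s))
      (pcfg (m + 3) (tape_of x) (?h + shift Stay) (pad m x s @ [True]))"
    by (intro step_append_same[where a = 0]) (auto simp: program_pad_otm)
  then have 1: "step (pad_otm m) B (pcfg (m + 5) (tape_of x) ?h (pad m x s))
      (pcfg (m + 3) (tape_of x) ?h (pad m x (Suc s)))" unfolding e by simp
  have 2: "step (pad_otm m) B (pcfg (m + 3) (tape_of x) ?h (pad m x (Suc s)))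
      (pcfg q' (tape_of x) ?h (pad m x (Suc s)))"
    by (rule step_query_cfg) (simp_all add: assms)
  have "(step (pad_otm m) B ^^ (0 + 1 + 1)) (pcfg (m + 5) (tape_of x) ?h (pad m x s))
      (pcfg q' (tape_of x) ?h (pad m x (Suc s)))"
    by (rule steps_snoc[OF steps_snoc[OF relpowp_0_I 1] 2])
  then show ?thesis by (simp only: add_0_left one_add_one)
qed

lemma pad_loop:
  assumes "\<And>s. 0 < s \<Longrightarrow> pad m x s \<in> B \<longleftrightarrow> N \<le> s"
  shows "s < N \<Longrightarrow> (step (pad_otm m) B ^^ (2 * s)) (pcfg (m + 5) (tape_of x) (int (length x)) (pad m x 0))
     (pcfg (m + 5) (tape_of x) (int (length x)) (pad m x s))"
proof (induction s)
  case (Suc s)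
  have 1: "(step (pad_otm m) B ^^ (2 * s)) (pcfg (m + 5) (tape_of x) (int (length x)) (pad m x 0))
     (pcfg (m + 5) (tape_of x) (int (length x)) (pad m x s))" using Suc by simp
  have 2: "(step (pad_otm m) B ^^ 2) (pcfg (m + 5) (tape_of x) (int (length x)) (pad m x s))
     (pcfg (m + 5) (tape_of x) (int (length x)) (pad m x (Suc s)))"
    by (rule pad_extend) (use assms[of "Suc s"] Suc.prems in simp)
  have "2 * Suc s = 2 * s + 2" by simp
  then show ?case using relpowp_trans[OF 1 2] by (simp only:)
qed simp

lemma pad_run:
  assumes N: "\<And>s. 0 < s \<Longrightarrow> pad m x s \<in> B \<longleftrightarrow> N \<le> s" "0 < N"
  shows "\<exists>T c. T \<le> m + length x + 2 * N + 5 \<and> (step (pad_otm m) B ^^ T) (init (pad_otm m) x) c \<and>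
    (\<nexists>c'. step (pad_otm m) B c c') \<and> (state c = m + 2 \<longleftrightarrow> pad m x N @ [False] \<in> B)"
proof -
  let ?s = "step (pad_otm m) B" and ?h = "int (length x)" and ?t = "(tape_of x)(int (length x) := 1)"
  let ?w = "pad m x N @ [False]"
  define q where "q = (if ?w \<in> B then m + 4 else m + 5)"
  obtain k where k: "N = Suc k" using N(2) by (cases N) auto
  have 2: "(?s ^^ (2 * k)) (pcfg (m + 5) (tape_of x) ?h (pad m x 0)) (pcfg (m + 5) (tape_of x) ?h (pad m x k))"
    by (rule pad_loop[where N = N]) (use N(1) k in simp_all)
  have 3: "(?s ^^ 2) (pcfg (m + 5) (tape_of x) ?h (pad m x k)) (pcfg (m + 4) (tape_of x) ?h (pad m x N))"
    unfolding k by (rule pad_extend) (use N(1)[of N] k in simp)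
  \<comment> \<open>The mark 1 on tape 0 makes the next positive answer lead to acceptance instead
    of here again.\<close>
  have 4: "?s (pcfg (m + 4) (tape_of x) ?h (pad m x N)) (pcfg (m + 3) ?t (?h + shift Stay) ?w)"
    by (intro step_append[where a = 0]) (auto simp: program_pad_otm)
  have 5: "?s (pcfg (m + 3) ?t (?h + shift Stay) ?w) (pcfg q ?t (?h + shift Stay) ?w)"
    by (rule step_query_cfg) (simp_all add: q_def)
  have "m + 1 + length x + 1 + 2 * k + 2 + 1 + 1 = m + length x + 2 * N + 4" using k by simp
  then have run: "(?s ^^ (m + length x + 2 * N + 4)) (init (pad_otm m) x) (pcfg q ?t ?h ?w)"
    using steps_snoc[OF steps_snoc[OF relpowp_trans[OF relpowp_trans[OF pad_write_prefix 2] 3] 4] 5]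
    by (simp only: shift.simps add_0_right)
  show ?thesis
  proof (cases "?w \<in> B")
    case True
    define c where "c = cfg (m + 2) (?t(?h := 1)) ((tape_of ?w)(int (length ?w) := 0))
        (?h + shift Stay) (int (length ?w) + shift Stay)"
    have "?s (pcfg (m + 4) ?t ?h ?w) c"
      unfolding c_def by (intro step_cfg) (auto simp: program_pad_otm simp del: length_append)
    then have "(?s ^^ (m + length x + 2 * N + 4 + 1)) (init (pad_otm m) x) c"
      using steps_snoc[OF run] True unfolding q_def by presburger
    moreover have "state c = m + 2" by (simp add: c_def)
    moreover from this have "\<nexists>c'. ?s c c'" using accepting_halts[OF wf_pad_otm] by simp
    ultimately show ?thesis using True
      by (intro exI[of _ "m + length x + 2 * N + 4 + 1"] exI[of _ c]) simp
  next
    case False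
    \<comment> \<open>In state \<open>m + 5\<close> only the blank on tape 0 has an instruction, so
      with the mark present a negative answer halts.\<close>
    have "\<not> ?s (pcfg (m + 5) ?t ?h ?w) c'" for c'
      by (auto elim!: step.cases simp: program_pad_otm scanned_cfg)
    then have "\<nexists>c'. ?s (pcfg q ?t ?h ?w) c'" using False by (simp add: q_def)
    then show ?thesis using run False
      by (intro exI[of _ "m + length x + 2 * N + 4"] exI[of _ "pcfg q ?t ?h ?w"]) (simp add: q_def)
  qed
qed

text \<open>The machine never evaluates the polynomial: the oracle itself signals sufficient
  padding, so one program per index \<open>m\<close> works for every \<open>q\<close>. The bound
  must be positive because the loop appends a bit before it first asks.\<close>

lemma padded_language_in_P:
  assumes N: "\<And>x s. 0 < s \<Longrightarrow> pad m x s \<in> B \<longleftrightarrow> poly q (length x) \<le> s"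
    and q: "\<And>n. 0 < poly q n"
  shows "{x. pad m x (poly q (length x)) @ [False] \<in> B} \<in> P_class B"
proof -
  let ?p = "[:m + 5, 1:] + [:2:] * q"
  have "time_bounded (pad_otm m) B x (poly ?p (length x)) \<and>
    (accepts (pad_otm m) B x \<longleftrightarrow> pad m x (poly q (length x)) @ [False] \<in> B)" for x
  proof -
    obtain T c where T: "T \<le> m + length x + 2 * poly q (length x) + 5"
      "(step (pad_otm m) B ^^ T) (init (pad_otm m) x) c" "\<nexists>c'. step (pad_otm m) B c c'"
      and c: "state c = m + 2 \<longleftrightarrow> pad m x (poly q (length x)) @ [False] \<in> B"
      using pad_run[OF N q] by blast
    note run = deterministic_run[OF wf_pad_otm deterministic_pad_otm T(2,3)]
    have "T \<le> poly ?p (length x)" using T(1) by simp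
    then have "time_bounded (pad_otm m) B x (poly ?p (length x))"
      using run(1) unfolding time_bounded_def by (meson order_trans)
    then show ?thesis using run(2) c by simp
  qed
  then have "(\<forall>x. time_bounded (pad_otm m) B x (poly ?p (length x))) \<and>
    {x. pad m x (poly q (length x)) @ [False] \<in> B} = {x. accepts (pad_otm m) B x}" by blast
  then show ?thesis unfolding P_class_def using wf_pad_otm deterministic_pad_otm by blast
qed

section \<open>Coding of questions and the self-referential oracle\<close>

lemma replicate_True_False_eq:
  "replicate m True @ False # r = replicate n True @ False # r' \<longleftrightarrow> m = n \<and> r = r'"
proof (induction m arbitrary: n)
  case 0
  then show ?case by (cases n) auto
next
  case (Suc m)
  then show ?case by (cases n) auto
qed

text \<open>The code is read from both ends: the first \<open>False\<close> ends the index, and the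
  last one, which becomes the first after reversal, precedes the padding.\<close>

lemma pad_eq_iff: "pad m x s = pad n y t \<longleftrightarrow> m = n \<and> x = y \<and> s = t"
proof -
  have "(x @ [False]) @ replicate s True = (y @ [False]) @ replicate t True \<longleftrightarrow>
    replicate s True @ False # rev x = replicate t True @ False # rev y"
    by (subst rev_is_rev_conv[symmetric]) simp
  then show ?thesis by (auto simp: pad_def pad_prefix_def replicate_True_False_eq)
qed

text \<open>This separates the two kinds of questions. Without padding the string ends with the
  separator \<open>False\<close> and could be of the other kind.\<close>

lemma pad_neq_False: "0 < s \<Longrightarrow> pad m x s \<noteq> w @ [False]"
  by (cases s) (auto simp: pad_def simp flip: replicate_append_same)

lemma length_pad: "length (pad m x s) = m + length x + s + 2"
  by (simp add: pad_def pad_prefix_def)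

context
  fixes F :: "nat \<Rightarrow> bool list set \<Rightarrow> bool list set" and q :: "nat \<Rightarrow> nat poly" and D :: "bool list set" and k :: nat
begin

text \<open>A string \<open>pad m x s\<close> asks whether \<open>s\<close> is enough padding, and \<open>pad m x s @ [False]\<close> asks whether
  \<open>x \<in> F m A\<close> for the oracle \<open>A\<close> under construction; by locality, for sufficient \<open>s\<close> the strings shorter than
  the question determine the answer.\<close>

definition answer :: "bool list set \<Rightarrow> bool list \<Rightarrow> bool" where
  "answer S w \<longleftrightarrow> (if length w < k then w \<in> D
     else (\<exists>m x s. 0 < s \<and> w = pad m x s \<and> poly (q m) (length x) \<le> s) \<or>
          (\<exists>m x s. w = pad m x s @ [False] \<and> x \<in> F m S))"

primrec stage :: "nat \<Rightarrow> bool list set" where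
  "stage 0 = {}"
| "stage (Suc n) = stage n \<union> {w. length w = n \<and> answer (stage n) w}"

definition self_oracle :: "bool list set" where
  "self_oracle = (\<Union>n. stage n)"

lemma stage_iff: "w \<in> stage n \<longleftrightarrow> length w < n \<and> answer (stage (length w)) w"
  by (induction n) (auto simp: less_Suc_eq)

lemma self_oracle_iff: "w \<in> self_oracle \<longleftrightarrow> answer (stage (length w)) w"
  unfolding self_oracle_def using stage_iff by blast

lemma stage_eq_self_oracle: "length w < n \<Longrightarrow> w \<in> stage n \<longleftrightarrow> w \<in> self_oracle"
  by (simp add: stage_iff[of w n] self_oracle_iff)

lemma self_oracle_extends: "length w < k \<Longrightarrow> w \<in> self_oracle \<longleftrightarrow> w \<in> D"
  by (simp add: self_oracle_iff answer_def)

text \<open>Questions with index \<open>m \<ge> k\<close> have length at least \<open>k\<close>, so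
  the prescribed part \<open>D\<close> does not interfere. A question about membership is longer
  than its padding \<open>poly (q m) (length x)\<close>, so its stage already contains all that
  \<open>F m\<close> looks at.\<close>

lemma self_oracle_decides:
  assumes F: "local_op (F m) (q m)" and q: "\<And>n. 0 < poly (q m) n" and m: "k \<le> m"
  shows "F m self_oracle \<in> P_class self_oracle"
proof -
  have 1: "pad m x s \<in> self_oracle \<longleftrightarrow> poly (q m) (length x) \<le> s" if "0 < s" for x s
    using that m by (auto simp: self_oracle_iff answer_def length_pad pad_eq_iff pad_neq_False)
  have 2: "pad m x (poly (q m) (length x)) @ [False] \<in> self_oracle \<longleftrightarrow> x \<in> F m self_oracle" for x
  proof -
    let ?w = "pad m x (poly (q m) (length x)) @ [False]"
    have "?w \<in> self_oracle \<longleftrightarrow> x \<in> F m (stage (length ?w))"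
      using m pad_neq_False[symmetric] unfolding self_oracle_iff answer_def
      by (auto simp: length_pad pad_eq_iff)
    also have "\<dots> \<longleftrightarrow> x \<in> F m self_oracle"
      by (intro local_opD[OF F] stage_eq_self_oracle) (simp add: length_pad)
    finally show ?thesis .
  qed
  show ?thesis using padded_language_in_P[OF 1 q] unfolding 2 by simp
qed

end

lemma exists_self_deciding_oracle:
  fixes F :: "nat \<Rightarrow> bool list set \<Rightarrow> bool list set" and D :: "bool list set"
  assumes q: "\<And>j. local_op (F j) (q j)"
  shows "\<exists>A. (\<forall>w. length w < k \<longrightarrow> (w \<in> A \<longleftrightarrow> w \<in> D)) \<and> (\<forall>j. F j A \<in> P_class A)"
proof -
  \<comment> \<open>Decoding pairs repeats each operator, and \<open>prod_encode (j, k)\<close> is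
    an index of \<open>F j\<close> that is at least \<open>k\<close>. Adding 1 makes the padding
    bound positive.\<close>
  define G r where "G m = F (fst (prod_decode m))" and "r m = q (fst (prod_decode m)) + 1" for m
  have G: "local_op (G m) (r m)" for m
    unfolding local_op_def
  proof (intro allI impI)
    fix x :: "bool list" and B B' :: "bool list set"
    assume "\<forall>w. length w \<le> poly (r m) (length x) \<longrightarrow> (w \<in> B) = (w \<in> B')"
    then show "(x \<in> G m B) = (x \<in> G m B')"
      unfolding G_def by (intro local_opD[OF q]) (simp add: r_def)
  qed
  define A where "A = self_oracle G r D k"
  have "F j A \<in> P_class A" for j
  proof -
    have "G (prod_encode (j, k)) A \<in> P_class A"
      unfolding A_def by (intro self_oracle_decides G le_prod_encode_2) (simp add: r_def)
    then show ?thesis by (simp add: G_def)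
  qed
  then show ?thesis unfolding A_def using self_oracle_extends[where D = D and k = k] by blast
qed

section \<open>Parity in polynomial space\<close>

lemma step_head:
  assumes "step M B c c'" "wf_otm M"
  shows "\<bar>head c' i\<bar> \<le> \<bar>head c i\<bar> + 1"
  using assms(1)
proof cases
  case (step_instr j)
  then show ?thesis using abs_shift[of "moves j ! i"] by (auto simp: exec_def)
next
  case step_query
  then show ?thesis by simp
qed

lemma relpowp_step_head:
  assumes "wf_otm M"
  shows "(step M B ^^ n) (init M x) c \<Longrightarrow> \<bar>head c i\<bar> \<le> int n"
proof (induction n arbitrary: c)
  case 0
  then show ?case by (auto simp: init_def)
next
  case (Suc n)
  then obtain d where "(step M B ^^ n) (init M x) d" "step M B d c" by (auto elim: relpowp_Suc_E)
  then show ?case using Suc.IH[of d] step_head[OF \<open>step M B d c\<close> assms, of i] by linarith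
qed

lemma time_bounded_halts:
  assumes "time_bounded M B x t"
  shows "halts M B x"
proof (rule ccontr)
  assume "\<not> halts M B x"
  then have next_step: "\<exists>d. step M B c d" if "(step M B)\<^sup>*\<^sup>* (init M x) c" for c
    using that unfolding halts_def by blast
  have "\<exists>c. (step M B ^^ n) (init M x) c" for n
  proof (induction n)
    case (Suc n)
    then obtain c where c: "(step M B ^^ n) (init M x) c" by blast
    then show ?case using next_step[OF relpowp_imp_rtranclp[OF c]] by auto
  qed auto
  then obtain c where "(step M B ^^ Suc t) (init M x) c" by blast
  then have "Suc t \<le> t" using assms unfolding time_bounded_def by blast
  then show False by simp
qed

lemma P_subset_PSPACE: "P_class B \<subseteq> PSPACE B"
proof
  fix L assume "L \<in> P_class B"
  then obtain M p where M: "wf_otm M" "deterministic M" "L = {x. accepts M B x}"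
    and p: "\<And>x. time_bounded M B x (poly p (length x))"
    unfolding P_class_def by blast
  have "space_bounded M B x (poly p (length x))" for x
    unfolding space_bounded_def
  proof (intro allI impI)
    fix c i assume "(step M B)\<^sup>*\<^sup>* (init M x) c"
    then obtain n where n: "(step M B ^^ n) (init M x) c" by (auto dest: rtranclp_imp_relpowp)
    have "\<bar>head c i\<bar> \<le> int n" by (rule relpowp_step_head[OF M(1) n])
    moreover have "n \<le> poly p (length x)" using p n unfolding time_bounded_def by blast
    ultimately show "\<bar>head c i\<bar> \<le> int (poly p (length x))" by linarith
  qed
  then show "L \<in> PSPACE B" unfolding PSPACE_def using M time_bounded_halts[OF p] by blast
qed

text \<open>A deterministic relation has a single path, so whatever is reachable lies on the given
  halting path. It thus suffices to exhibit one run inside the space bound.\<close>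

lemma rtranclp_unique_path:
  assumes R: "right_unique R" and SR: "\<And>c d. S c d \<Longrightarrow> R c d"
    and path: "S\<^sup>*\<^sup>* a b" and halt: "\<nexists>c. R b c" and d: "R\<^sup>*\<^sup>* a d"
  shows "S\<^sup>*\<^sup>* a d \<and> S\<^sup>*\<^sup>* d b"
  using d
proof (induction rule: rtranclp_induct)
  case base
  then show ?case using path by simp
next
  case (step d e)
  from step.IH have "S\<^sup>*\<^sup>* d b" ..
  then show ?case
  proof (cases rule: converse_rtranclpE)
    case base
    then show ?thesis using halt step.hyps(2) by blast
  next
    case (step y)
    have "y = e" by (rule right_uniqueD[OF R SR[OF step(1)] \<open>R d e\<close>])
    moreover have "S\<^sup>*\<^sup>* a y"
      using \<open>S\<^sup>*\<^sup>* a d \<and> _\<close> step(1) rtranclp.rtrancl_into_rtrancl[of S a d y] by blast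
    ultimately show ?thesis using step(2) by simp
  qed
qed

definition bstep :: "otm \<Rightarrow> bool list set \<Rightarrow> nat \<Rightarrow> config \<Rightarrow> config \<Rightarrow> bool" where
  "bstep M B s c c' \<longleftrightarrow> step M B c c' \<and> (\<forall>i<tapes M. \<bar>head c' i\<bar> \<le> int s)"

lemma bounded_deterministic_run:
  assumes M: "wf_otm M" "deterministic M"
    and run: "(bstep M B s)\<^sup>*\<^sup>* (init M x) c" and halt: "\<nexists>c'. step M B c c'"
  shows "space_bounded M B x s" "halts M B x" "accepts M B x \<longleftrightarrow> state c = accept M"
proof -
  note path = rtranclp_unique_path[OF step_functional[OF M(2)] _ run halt]
  have on_path: "(bstep M B s)\<^sup>*\<^sup>* (init M x) d \<and> (bstep M B s)\<^sup>*\<^sup>* d c" if "(step M B)\<^sup>*\<^sup>* (init M x) d" for d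
    using path[OF _ that] by (simp add: bstep_def)
  have "\<forall>i<tapes M. \<bar>head d i\<bar> \<le> int s" if "(bstep M B s)\<^sup>*\<^sup>* (init M x) d" for d
    using that by cases (auto simp: init_def bstep_def)
  then show "space_bounded M B x s" unfolding space_bounded_def using on_path by blast
  have reach: "(step M B)\<^sup>*\<^sup>* (init M x) c"
    using run by (rule rtranclp_mono[THEN predicate2D, rotated]) (auto simp: bstep_def)
  then show "halts M B x" unfolding halts_def using halt by blast
  have "d = c" if "(step M B)\<^sup>*\<^sup>* (init M x) d" "state d = accept M" for d
  proof -
    have "(bstep M B s)\<^sup>*\<^sup>* d c" using on_path[OF that(1)] ..
    then show ?thesis
      by (cases rule: converse_rtranclpE) (use accepting_halts[OF M(1) that(2)] in \<open>auto simp: bstep_def\<close>)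
  qed
  then show "accepts M B x \<longleftrightarrow> state c = accept M" unfolding accepts_def using reach by blast
qed

text \<open>The query tape is a binary counter, least significant digit first, of the length of the input. The cell
  behind the input on tape 0 holds the parity of the number of positive answers. States: 0 fill the counter with
  zeros, 1 rewind, 5 increment.\<close>

definition parity_otm :: otm where
  "parity_otm = OTM 2 0 2 3 4 5
    (map (\<lambda>a. Instr 0 [a, 0] 0 [a, 1] [Right, Right]) [1, 2] @
     [Instr 0 [0, 0] 1 [0, 0] [Stay, Left]] @
     map (\<lambda>(a, b). Instr 1 [a, b] 1 [a, b] [Stay, Left]) (List.product [0, 1] [1, 2]) @
     map (\<lambda>a. Instr 1 [a, 0] 3 [a, 0] [Stay, Right]) [0, 1] @
     map (\<lambda>(a, b). Instr 4 [a, b] 5 [1 - a, b] [Stay, Stay]) (List.product [0, 1] [0, 1, 2]) @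
     map (\<lambda>a. Instr 5 [a, 2] 5 [a, 1] [Stay, Right]) [0, 1] @
     map (\<lambda>a. Instr 5 [a, 1] 1 [a, 2] [Stay, Left]) [0, 1] @
     [Instr 5 [1, 0] 2 [1, 0] [Stay, Stay]])"

lemma parity_otm_simps [simp]:
  "tapes parity_otm = 2" "start parity_otm = 0" "accept parity_otm = 2"
  "query parity_otm = 3" "yes parity_otm = 4" "no parity_otm = 5"
  by (simp_all add: parity_otm_def)

lemma program_parity_otm:
  "set (program parity_otm) =
     (\<lambda>a. Instr 0 [a, 0] 0 [a, 1] [Right, Right]) ` {1, 2} \<union>
     ({Instr 0 [0, 0] 1 [0, 0] [Stay, Left]} \<union>
     ((\<lambda>(a, b). Instr 1 [a, b] 1 [a, b] [Stay, Left]) ` ({0, 1} \<times> {1, 2}) \<union>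
     ((\<lambda>a. Instr 1 [a, 0] 3 [a, 0] [Stay, Right]) ` {0, 1} \<union>
     ((\<lambda>(a, b). Instr 4 [a, b] 5 [1 - a, b] [Stay, Stay]) ` ({0, 1} \<times> {0, 1, 2}) \<union>
     ((\<lambda>a. Instr 5 [a, 2] 5 [a, 1] [Stay, Right]) ` {0, 1} \<union>
     ((\<lambda>a. Instr 5 [a, 1] 1 [a, 2] [Stay, Left]) ` {0, 1} \<union>
     {Instr 5 [1, 0] 2 [1, 0] [Stay, Stay]}))))))"
  unfolding parity_otm_def otm.sel set_append set_map set_product list.set ..

lemma wf_parity_otm: "wf_otm parity_otm"
  unfolding wf_otm_def program_parity_otm ball_Un by simp

lemma deterministic_parity_otm: "deterministic parity_otm"
  unfolding deterministic_def program_parity_otm ball_Un by simp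

lemma bstep_cfg:
  assumes "Instr q [a, b] q' [a', b'] [u, v] \<in> set (program M)" "tapes M = 2" "q \<noteq> query M"
    and "t0 h0 = a" "t1 h1 = b" "t0(h0 := a') = t0'" "t1(h1 := b') = t1'"
    and "h0 + shift u = h0'" "h1 + shift v = h1'" "\<bar>h0'\<bar> \<le> int s" "\<bar>h1'\<bar> \<le> int s"
  shows "bstep M B s (cfg q t0 t1 h0 h1) (cfg q' t0' t1' h0' h1')"
proof -
  have "step M B (cfg q t0 t1 h0 h1) (cfg q' t0' t1' h0' h1')"
    using step_cfg[OF assms(1-3), of t0 h0 t1 h1 B] assms(4,5) unfolding assms(6-9) by blast
  then show ?thesis unfolding bstep_def using assms by (auto simp: less_2_cases_iff)
qed

lemma bstep_query_cfg:
  assumes "q = query M" "q' = (if w \<in> B then yes M else no M)" "tapes M = 2"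
    and "\<bar>h0\<bar> \<le> int s" "\<bar>h1\<bar> \<le> int s"
  shows "bstep M B s (cfg q t0 (tape_of w) h0 h1) (cfg q' t0 (tape_of w) h0 h1)"
  unfolding bstep_def using step_query_cfg[OF assms(1,2)] assms by (auto simp: less_2_cases_iff)

lemma tape_of_update: "n < length w \<Longrightarrow> (tape_of w)(int n := bit_symbol b) = tape_of (w[n := b])"
  by (auto simp: tape_of_def fun_eq_iff nth_list_update)

context
  fixes B :: "bool list set" and x :: "bool list" and n :: nat
  assumes n: "n = length x"
begin

abbreviation reaches :: "config \<Rightarrow> config \<Rightarrow> bool" where
  "reaches \<equiv> (bstep parity_otm B (n + 1))\<^sup>*\<^sup>*"

text \<open>The parity is stored as 0 or 1 rather than as a bit symbol: 0 is the blank, so the cell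
  behind the input starts out as \<open>False\<close>.\<close>

definition pc :: "nat \<Rightarrow> bool \<Rightarrow> int \<Rightarrow> bool list \<Rightarrow> config" where
  "pc q p h w = cfg q ((tape_of x)(int n := of_bool p)) (tape_of w) (int n) h"

lemma reaches_pc:
  assumes "Instr q [of_bool p, b] q' [of_bool p', b'] [Stay, v] \<in> set (program parity_otm)" "q \<noteq> 3"
    and "tape_of w h = b" "(tape_of w)(h := b') = tape_of w'" "h + shift v = h'" "\<bar>h'\<bar> \<le> int (n + 1)"
  shows "reaches (pc q p h w) (pc q' p' h' w')"
  unfolding pc_def using assms by (intro r_into_rtranclp bstep_cfg[OF assms(1)]) auto

lemma rewind:
  "length w = n \<Longrightarrow> j \<le> n \<Longrightarrow> reaches (pc 1 p (int j - 1) w) (pc 3 p 0 w)"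
proof (induction j)
  case 0
  have "reaches (pc 1 p (- 1) w) (pc 3 p 0 w)"
    by (rule reaches_pc[where b = 0 and b' = 0 and v = Right])
       (auto simp: program_parity_otm tape_of_def fun_eq_iff)
  then show ?case by simp
next
  case (Suc j)
  have "reaches (pc 1 p (int j) w) (pc 1 p (int j - 1) w)"
    by (rule reaches_pc[where b = "tape_of w (int j)" and b' = "tape_of w (int j)" and v = Left])
       (use Suc.prems in \<open>auto simp: program_parity_otm tape_of_nth bit_symbol_def\<close>)
  then show ?case using Suc by (auto intro: rtranclp_trans)
qed

text \<open>\<open>v\<close> holds the fixed high-order digits of the counter, and \<open>u\<close>
  runs through the low-order ones.\<close>

definition odd_count :: "nat \<Rightarrow> bool list \<Rightarrow> bool" where
  "odd_count k v \<longleftrightarrow> odd (card {u. length u = k \<and> u @ v \<in> B})"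

lemma odd_count_0: "odd_count 0 v \<longleftrightarrow> v \<in> B"
proof -
  have "{u. length u = 0 \<and> u @ v \<in> B} = (if v \<in> B then {[]} else {})" by auto
  then show ?thesis by (simp add: odd_count_def)
qed

lemma odd_count_Suc: "odd_count (Suc k) v \<longleftrightarrow> odd_count k (False # v) \<noteq> odd_count k (True # v)"
proof -
  let ?U = "\<lambda>b. {u. length u = k \<and> u @ b # v \<in> B}"
  have fin: "finite (?U b)" for b
    by (rule finite_subset[OF _ finite_strings_le[of k]]) auto
  have "{u. length u = Suc k \<and> u @ v \<in> B} = (\<lambda>u. u @ [False]) ` ?U False \<union> (\<lambda>u. u @ [True]) ` ?U True"
    (is "?L = ?R")
  proof
    show "?L \<subseteq> ?R"
    proof
      fix u assume u: "u \<in> ?L"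
      then obtain u' b where "u = u' @ [b]" by (cases u rule: rev_cases) auto
      then show "u \<in> ?R" using u by (cases b) auto
    qed
  qed auto
  then have "card {u. length u = Suc k \<and> u @ v \<in> B} =
      card ((\<lambda>u. u @ [False]) ` ?U False) + card ((\<lambda>u. u @ [True]) ` ?U True)"
    using fin by (simp only:, intro card_Un_disjoint) auto
  also have "\<dots> = card (?U False) + card (?U True)"
    by (simp add: card_image inj_on_def)
  finally show ?thesis by (auto simp: odd_count_def)
qed

text \<open>The recursion of the binary counter: to pass through all values of the first \<open>k + 1\<close> digits,
  pass twice through those of the first \<open>k\<close>.\<close>

lemma count_block:
  "k + length v = n \<Longrightarrow>
    reaches (pc 3 p 0 (replicate k False @ v)) (pc 5 (p \<noteq> odd_count k v) (int k) (replicate k False @ v))"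
proof (induction k arbitrary: v p)
  case 0
  show ?case
  proof (cases "v \<in> B")
    case True
    have "reaches (pc 3 p 0 v) (pc 4 p 0 v)"
      unfolding pc_def using True by (intro r_into_rtranclp bstep_query_cfg) auto
    also have "reaches (pc 4 p 0 v) (pc 5 (\<not> p) 0 v)"
      by (rule reaches_pc[where b = "tape_of v 0" and b' = "tape_of v 0" and v = Stay])
         (use tape_of_symbols[of v 0] in \<open>auto simp: program_parity_otm\<close>)
    finally show ?thesis using True by (simp add: odd_count_0)
  next
    case False
    have "reaches (pc 3 p 0 v) (pc 5 p 0 v)"
      unfolding pc_def using False by (intro r_into_rtranclp bstep_query_cfg) auto
    then show ?thesis using False by (simp add: odd_count_0)
  qed
next
  case (Suc k)
  let ?F = "replicate k False @ False # v" and ?T = "replicate k False @ True # v"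
  let ?p = "p \<noteq> odd_count k (False # v)"
  let ?p' = "?p \<noteq> odd_count k (True # v)"
  have F: "replicate (Suc k) False @ v = ?F" by (simp flip: replicate_append_same)
  have "reaches (pc 3 p 0 ?F) (pc 5 ?p (int k) ?F)" using Suc by simp
  \<comment> \<open>The first pass ends with a carry into digit \<open>k\<close>, which turns it on
    and starts the second pass.\<close>
  also have "reaches (pc 5 ?p (int k) ?F) (pc 1 ?p (int k - 1) ?T)"
    by (rule reaches_pc[where b = 1 and b' = 2 and v = Left])
       (use Suc.prems tape_of_update[of k ?F True]
         in \<open>auto simp: program_parity_otm tape_of_nth nth_append list_update_append\<close>)
  also have "reaches (pc 1 ?p (int k - 1) ?T) (pc 3 ?p 0 ?T)" using Suc.prems by (intro rewind) auto
  also have "reaches (pc 3 ?p 0 ?T) (pc 5 ?p' (int k) ?T)" using Suc by simp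
  \<comment> \<open>The carry of the second pass clears digit \<open>k\<close> and moves on to digit
    \<open>k + 1\<close>.\<close>
  also have "reaches (pc 5 ?p' (int k) ?T) (pc 5 ?p' (int (Suc k)) ?F)"
    by (rule reaches_pc[where b = 2 and b' = 1 and v = Right])
       (use Suc.prems tape_of_update[of k ?T False]
         in \<open>auto simp: program_parity_otm tape_of_nth nth_append list_update_append\<close>)
  also have "?p' \<longleftrightarrow> (p \<noteq> odd_count (Suc k) v)"
    unfolding odd_count_Suc by (cases p; cases "odd_count k (False # v)"; simp)
  finally show ?case unfolding F .
qed

lemma fill:
  "j \<le> n \<Longrightarrow> reaches (init parity_otm x) (cfg 0 (tape_of x) (tape_of (replicate j False)) (int j) (int j))"
proof (induction j)
  case 0
  then show ?case by (simp add: init_cfg)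
next
  case (Suc j)
  have "reaches (cfg 0 (tape_of x) (tape_of (replicate j False)) (int j) (int j))
      (cfg 0 (tape_of x) (tape_of (replicate (Suc j) False)) (int (Suc j)) (int (Suc j)))"
    by (rule r_into_rtranclp, rule bstep_cfg[where a = "tape_of x (int j)" and b = 0 and a' = "tape_of x (int j)" and b' = 1
          and u = Right and v = Right])
       (use Suc.prems n tape_of_append[of "replicate j False" False] tape_of_blank[of "replicate j False"] in
         \<open>auto simp: program_parity_otm tape_of_nth bit_symbol_def replicate_append_same
           simp flip: replicate_Suc\<close>)
  then show ?case using Suc by (auto intro: rtranclp_trans)
qed

lemma parity_run: "reaches (init parity_otm x) (pc 5 (odd (card {w \<in> B. length w = n})) (int n) (replicate n False))"
proof -
  have "reaches (init parity_otm x) (cfg 0 (tape_of x) (tape_of (replicate n False)) (int n) (int n))"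
    by (rule fill) simp
  also have "reaches (cfg 0 (tape_of x) (tape_of (replicate n False)) (int n) (int n))
      (pc 1 False (int n - 1) (replicate n False))"
    unfolding pc_def
    by (rule r_into_rtranclp, rule bstep_cfg[where a = 0 and b = 0 and a' = 0 and b' = 0 and u = Stay and v = Left])
       (use n in \<open>auto simp: program_parity_otm tape_of_def\<close>)
  also have "reaches (pc 1 False (int n - 1) (replicate n False)) (pc 3 False 0 (replicate n False))"
    by (intro rewind) auto
  also have "reaches (pc 3 False 0 (replicate n False)) (pc 5 (odd_count n []) (int n) (replicate n False))"
    using count_block[of n "[]" False] by simp
  also have "odd_count n [] \<longleftrightarrow> odd (card {w \<in> B. length w = n})"
    by (simp add: odd_count_def conj_commute)
  finally show ?thesis .
qed

text \<open>The heads stay between -1 and \<open>n\<close>; the bound \<open>n + 1\<close> rather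
  than \<open>n\<close> matters for the empty input, where rewinding visits cell -1. The final carry
  reaches the blank cell \<open>n\<close> of the counter, where only parity 1 has an instruction,
  leading to acceptance.\<close>

lemma parity_decided:
  "space_bounded parity_otm B x (n + 1) \<and> halts parity_otm B x \<and>
    (accepts parity_otm B x \<longleftrightarrow> odd (card {w \<in> B. length w = n}))"
proof (cases "odd (card {w \<in> B. length w = n})")
  case True
  let ?w = "replicate n False"
  have "reaches (pc 5 True (int n) ?w) (pc 2 True (int n) ?w)"
    by (rule reaches_pc[where b = 0 and b' = 0 and v = Stay])
       (auto simp: program_parity_otm tape_of_def fun_eq_iff)
  then have run: "reaches (init parity_otm x) (pc 2 True (int n) ?w)"
    using parity_run True by (auto intro: rtranclp_trans)
  have st: "state (pc 2 True (int n) ?w) = accept parity_otm" by (simp add: pc_def)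
  have halt: "\<nexists>c'. step parity_otm B (pc 2 True (int n) ?w) c'"
    using accepting_halts[OF wf_parity_otm st] by blast
  show ?thesis
    using bounded_deterministic_run[OF wf_parity_otm deterministic_parity_otm run halt] True st by simp
next
  case False
  let ?c = "pc 5 False (int n) (replicate n False)"
  have run: "reaches (init parity_otm x) ?c" using parity_run False by simp
  have "tape_of (replicate n False) (int n) = 0" by (simp add: tape_of_def)
  then have halt: "\<nexists>c'. step parity_otm B ?c c'"
    by (auto elim!: step.cases simp: program_parity_otm scanned_cfg pc_def)
  show ?thesis
    using bounded_deterministic_run[OF wf_parity_otm deterministic_parity_otm run halt] False
    by (simp add: pc_def)
qed

end

lemma parity_in_PSPACE: "{x. odd (card {w \<in> B. length w = length x})} \<in> PSPACE B"
proof -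
  have "\<forall>x. space_bounded parity_otm B x (poly [:1, 1:] (length x))"
    using parity_decided[OF refl] by simp
  moreover have "\<forall>x. halts parity_otm B x" using parity_decided[OF refl] by blast
  moreover have "{x. odd (card {w \<in> B. length w = length x})} = {x. accepts parity_otm B x}"
    using parity_decided[OF refl] by blast
  ultimately show ?thesis
    unfolding PSPACE_def using wf_parity_otm deterministic_parity_otm by blast
qed

section \<open>Finite extensions and genericity\<close>

lemma closed_avoid:
  fixes F :: "(nat \<Rightarrow> bool) set"
  assumes "closed F" "A \<notin> F"
  shows "\<exists>N. \<forall>A'. (\<forall>i<N. A' i = A i) \<longrightarrow> A' \<notin> F"
proof -
  have "openin (product_topology (\<lambda>_. euclidean) UNIV) (- F)"
    using assms(1) by (simp add: open_fun_def closed_def)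
  then obtain X where X: "A \<in> PiE UNIV X" "finite {i. X i \<noteq> topspace euclidean}" "PiE UNIV X \<subseteq> - F"
    using product_topology_open_contains_basis[of "\<lambda>_. euclidean" UNIV "- F" A] assms(2) by auto
  obtain N where N: "\<And>i. X i \<noteq> UNIV \<Longrightarrow> i < N"
    using X(2) by (auto simp: finite_nat_set_iff_bounded)
  have "A' \<notin> F" if "\<forall>i<N. A' i = A i" for A'
  proof -
    have "A' i \<in> X i" for i
      using X(1) N[of i] that by (cases "X i = UNIV") (auto simp: PiE_iff)
    then show ?thesis using X(3) by (auto simp: PiE_iff)
  qed
  then show ?thesis by blast
qed

text \<open>In the Cantor space this says that \<open>R\<close> contains a dense open set, and
  \<open>forceable_generic\<close> is Baire's theorem for such sets.\<close>

definition forceable :: "((nat \<Rightarrow> bool) \<Rightarrow> bool) \<Rightarrow> bool" where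
  "forceable R \<longleftrightarrow> (\<forall>A N. \<exists>A' N'. (\<forall>i<N. A' i = A i) \<and> (\<forall>A''. (\<forall>i<N'. A'' i = A' i) \<longrightarrow> R A''))"

lemma forceable_generic:
  assumes "\<And>j :: nat. forceable (R j)"
  shows "\<exists>A. \<forall>j. R j A"
proof -
  let ?Q = "\<lambda>n (s :: (nat \<Rightarrow> bool) \<times> nat) s'. (\<forall>i<snd s. fst s' i = fst s i) \<and> snd s \<le> snd s' \<and> n < snd s' \<and>
    (\<forall>A. (\<forall>i<snd s'. A i = fst s' i) \<longrightarrow> R n A)"
  have "\<exists>s'. True \<and> ?Q n s s'" for n s
  proof -
    obtain A' N' where *: "\<forall>i<snd s. A' i = fst s i" "\<forall>A. (\<forall>i<N'. A i = A' i) \<longrightarrow> R n A"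
      using assms[of n] unfolding forceable_def by metis
    \<comment> \<open>Exceeding \<open>n\<close> ensures that every coordinate is fixed at some
      stage, so the stages have a limit.\<close>
    have "?Q n s (A', N' + snd s + n + 1)" using * by simp
    then show ?thesis by blast
  qed
  then obtain f where f: "\<And>n. ?Q n (f n) (f (Suc n))"
    using dependent_nat_choice[of "\<lambda>_ _. True" ?Q] by auto
  have agree: "m \<le> n \<Longrightarrow> snd (f m) \<le> snd (f n) \<and> (\<forall>i<snd (f m). fst (f n) i = fst (f m) i)" for m n
  proof (induction n rule: nat_induct_at_least)
    case base
    then show ?case by simp
  next
    case (Suc n)
    then show ?case using f[of n] by auto
  qed
  define A where "A i = fst (f (Suc i)) i" for i
  have "A i = fst (f n) i" if "i < snd (f n)" for i n
  proof (cases "Suc i \<le> n")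
    case True
    then show ?thesis using agree[OF True] f[of i] by (simp add: A_def)
  next
    case False
    then have "n \<le> Suc i" by simp
    then show ?thesis using agree[of n "Suc i"] that by (simp add: A_def)
  qed
  then have "R n A" for n using f[of n] by simp
  then show ?thesis by blast
qed

lemma forceable_generic_countable:
  assumes "countable \<R>" "\<And>R. R \<in> \<R> \<Longrightarrow> forceable R"
  shows "\<exists>A. \<forall>R\<in>\<R>. R A"
proof (cases "\<R> = {}")
  case False
  then have "\<exists>A. \<forall>j. from_nat_into \<R> j A"
    using assms(2) from_nat_into[OF False] by (intro forceable_generic) blast
  then show ?thesis using assms(1) by (metis from_nat_into_surj)
qed simp

section \<open>Strings against coordinates, and countability\<close>

lemma oracle_of_surj: "\<exists>A. oracle_of A = S"
proof -
  have "inj string_index" using bij_string_index by (simp add: bij_def)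
  then have "oracle_of (\<lambda>i. i \<in> string_index ` S) = S" by (auto simp: oracle_of_def inj_image_mem_iff)
  then show ?thesis by blast
qed

lemma length_le_string_index: "length w \<le> string_index w"
  by (induction w) auto

lemma oracle_of_agree:
  assumes "\<And>w. length w < N \<Longrightarrow> w \<in> oracle_of A' \<longleftrightarrow> w \<in> oracle_of A" "i < N"
  shows "A' i = A i"
proof -
  obtain w where w: "string_index w = i" using bij_string_index by (metis bij_pointE)
  have "length w < N" using length_le_string_index[of w] w assms(2) by simp
  then show ?thesis using assms(1)[of w] w by (simp add: oracle_of_def)
qed

lemma string_index_bound: "\<exists>N. \<forall>w. length w \<le> n \<longrightarrow> string_index w < N"
proof -
  have "finite (string_index ` {w. length w \<le> n})" by (intro finite_imageI finite_strings_le)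
  then show ?thesis by (auto simp: finite_nat_set_iff_bounded)
qed

instance move :: countable by countable_datatype
instance instr :: countable by countable_datatype
instance otm :: countable by countable_datatype

lemma countable_nat_poly: "countable (UNIV :: nat poly set)"
proof -
  have "(UNIV :: nat poly set) = range Poly" using Poly_coeffs by (metis surjI)
  then show ?thesis by (metis countableI_type countable_image)
qed

lemma countable_hierarchies: "countable (UNIV :: (otm \<times> nat poly) list set)"
proof -
  have "countable (UNIV \<times> UNIV :: (otm \<times> nat poly) set)"
    by (intro countable_SIGMA countable_nat_poly) auto
  then show ?thesis using countable_lists[of "UNIV :: (otm \<times> nat poly) set"] by simp
qed

lemma PH_hierarchy:
  "L \<in> PH B \<Longrightarrow> \<exists>cs. (\<forall>(M, p)\<in>set cs. wf_otm M) \<and> L = hierarchy cs B"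
  unfolding PH_def using Sigma_class_hierarchy by blast

text \<open>Deciding every operator of the countable family in \<open>P_class A\<close> collapses
  both classes to it.\<close>

lemma exists_collapsing_oracle:
  "\<exists>A. (\<forall>w. length w < k \<longrightarrow> (w \<in> A \<longleftrightarrow> w \<in> D)) \<and> PH A = PSPACE A"
proof -
  define \<O> where "\<O> = hierarchy ` {cs. \<forall>(M, p)\<in>set cs. wf_otm M} \<union> (\<lambda>(M, p). spaced M p) ` {(M, p). wf_otm M}"
  have "countable \<O>"
  proof -
    have "countable (UNIV \<times> UNIV :: (otm \<times> nat poly) set)"
      by (intro countable_SIGMA countable_nat_poly) auto
    then show ?thesis unfolding \<O>_def
      by (intro countable_Un countable_image countable_subset[OF subset_UNIV countable_hierarchies])
         (auto intro: countable_subset)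
  qed
  moreover have "\<O> \<noteq> {}" unfolding \<O>_def by (auto intro!: exI[of _ "[]"])
  ultimately have range: "range (from_nat_into \<O>) = \<O>" by simp
  have "\<exists>q. local_op F q" if "F \<in> \<O>" for F
    using that local_hierarchy local_spaced unfolding \<O>_def by auto
  then have "\<forall>j. \<exists>q. local_op (from_nat_into \<O> j) q" using range by blast
  from choice[OF this] obtain q where q: "\<And>j. local_op (from_nat_into \<O> j) (q j)" by blast
  obtain A where A: "\<forall>w. length w < k \<longrightarrow> (w \<in> A \<longleftrightarrow> w \<in> D)" "\<forall>j. from_nat_into \<O> j A \<in> P_class A"
    using exists_self_deciding_oracle[of "from_nat_into \<O>" q k D] q by blast
  have P: "F A \<in> P_class A" if "F \<in> \<O>" for F
    using A(2) that range by (metis imageE)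
  have "PH A \<subseteq> P_class A"
    using PH_hierarchy P unfolding \<O>_def by blast
  moreover have "PSPACE A \<subseteq> P_class A"
    using PSPACE_spaced P unfolding \<O>_def by blast
  moreover have "P_class A \<subseteq> PH A"
    unfolding PH_def using Sigma_class.simps(1) by blast
  ultimately have "PH A = PSPACE A" using P_subset_PSPACE by blast
  then show ?thesis using A(1) by blast
qed

lemma forceable_avoid:
  fixes F :: "(nat \<Rightarrow> bool) set"
  assumes "closed F" "\<And>A. A \<in> F \<Longrightarrow> PH (oracle_of A) \<noteq> PSPACE (oracle_of A)"
  shows "forceable (\<lambda>A. A \<notin> F)"
  unfolding forceable_def
proof (intro allI)
  fix A :: "nat \<Rightarrow> bool" and N
  obtain B where B: "\<forall>w. length w < N \<longrightarrow> (w \<in> B \<longleftrightarrow> w \<in> oracle_of A)" "PH B = PSPACE B"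
    using exists_collapsing_oracle[of N "oracle_of A"] by blast
  obtain A' where A': "oracle_of A' = B" using oracle_of_surj by blast
  have "A' \<notin> F" using assms(2) A' B(2) by blast
  then obtain N' where "\<forall>A''. (\<forall>i<N'. A'' i = A' i) \<longrightarrow> A'' \<notin> F" using closed_avoid[OF assms(1)] by blast
  moreover have "\<forall>i<N. A' i = A i" using oracle_of_agree[of N A' A] A' B(1) by blast
  ultimately show "\<exists>A' N'. (\<forall>i<N. A' i = A i) \<and> (\<forall>A''. (\<forall>i<N'. A'' i = A' i) \<longrightarrow> A'' \<notin> F)" by blast
qed

section \<open>Growth of polynomials\<close>

lemma Suc_le_two_power: "Suc j \<le> 2 ^ j"
  by (induction j) auto

lemma poly_le_monomial:
  "\<exists>C k. \<forall>n\<ge>1. poly Q n \<le> 2 ^ C * n ^ k" for Q :: "nat poly"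
proof (induction Q)
  case 0
  show ?case by simp
next
  case (pCons a Q)
  then obtain C k where IH: "\<And>n. n \<ge> 1 \<Longrightarrow> poly Q n \<le> 2 ^ C * n ^ k" by blast
  have "poly (pCons a Q) n \<le> 2 ^ (a + C) * n ^ Suc k" if n: "n \<ge> 1" for n
  proof -
    have "poly (pCons a Q) n \<le> a * n ^ Suc k + 2 ^ C * n ^ Suc k"
      using IH[OF n] n mult_le_mono2[OF IH[OF n], of n] by (simp add: mult_ac add_mono)
    also have "\<dots> = (a + 2 ^ C) * n ^ Suc k" by (rule distrib_right[symmetric])
    also have "a + 2 ^ C \<le> (a + 1) * 2 ^ C" by simp
    also have "\<dots> \<le> 2 ^ a * 2 ^ C" using Suc_le_two_power[of a] by (intro mult_le_mono1) simp
    finally show ?thesis by (simp add: power_add)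
  qed
  then show ?case by blast
qed

lemma square_le_two_power: "4 \<le> j \<Longrightarrow> j * j \<le> 2 ^ j" for j :: nat
proof (induction j rule: nat_induct_at_least)
  case (Suc j)
  have "4 * j \<le> j * j" using Suc.hyps by (rule mult_le_mono1)
  moreover have "Suc j * Suc j = j * j + 2 * j + 1" by simp
  ultimately have "Suc j * Suc j \<le> 2 * (j * j)" using Suc.hyps by linarith
  also have "\<dots> \<le> 2 ^ Suc j" using Suc.IH by simp
  finally show ?case .
qed simp

text \<open>Arbitrarily large \<open>n\<close> suffice, so \<open>n = 2 ^ j\<close> is taken: then
  both sides are powers of two and only the exponents \<open>C + j * k\<close> and
  \<open>2 ^ j\<close> are compared.\<close>

lemma poly_le_two_power: "\<exists>n\<ge>N. poly Q n \<le> 2 ^ n" for Q :: "nat poly"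
proof -
  obtain C k where Ck: "\<And>n. n \<ge> 1 \<Longrightarrow> poly Q n \<le> 2 ^ C * n ^ k" using poly_le_monomial by blast
  define j where "j = C + k + N + 4"
  have "C + j * k \<le> j * (k + 1)" by (simp add: j_def)
  also have "\<dots> \<le> j * j" by (rule mult_le_mono2) (simp add: j_def)
  also have "\<dots> \<le> 2 ^ j" by (rule square_le_two_power) (simp add: j_def)
  finally have le: "C + j * k \<le> 2 ^ j" .
  have "poly Q (2 ^ j) \<le> 2 ^ C * (2 ^ j) ^ k" by (rule Ck) simp
  also have "\<dots> = 2 ^ (C + j * k)" by (simp add: power_add power_mult)
  also have "\<dots> \<le> 2 ^ (2 ^ j)" by (rule power_increasing[OF le]) simp
  finally have "poly Q (2 ^ j) \<le> 2 ^ (2 ^ j)" .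
  moreover have "N \<le> 2 ^ j" using Suc_le_two_power[of j] unfolding j_def by linarith
  ultimately show ?thesis by blast
qed

text \<open>Letting only the strings of length \<open>n\<close> vary, a correct \<open>F\<close> would yield a polynomial of degree
  polynomial in \<open>n\<close> that agrees with the parity of \<open>2 ^ n\<close> variables on most inputs.\<close>

lemma exists_parity_violation:
  assumes "approximable F k d q"
  shows "\<exists>B x. (\<forall>w. length w < N \<longrightarrow> (w \<in> B \<longleftrightarrow> w \<in> S)) \<and>
    (x \<in> F B) \<noteq> odd (card {w \<in> B. length w = length x})"
proof -
  let ?Q = "[:8:] * ((q + [:3:]) ^ k * d + 1) ^ 2"
  obtain n where n: "N + 1 \<le> n" "poly ?Q n \<le> 2 ^ n" using poly_le_two_power by blast
  \<comment> \<open>The 3 makes the share of bad inputs at most 1/8, as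
    \<open>parity_not_approximable\<close> requires, and \<open>?Q\<close> is its expression
    \<open>8 * (D + 1)\<^sup>2\<close> as a polynomial in \<open>n\<close>.\<close>
  define l D where "l = poly q n + 3" and "D = l ^ k * poly d n"
  have D: "8 * (D + 1)\<^sup>2 \<le> 2 ^ n" using n(2) by (simp add: D_def l_def)
  define V where "V = {w :: bool list. length w = n}"
  have V: "finite V" "card V = 2 ^ n"
    using finite_lists_length_eq[of "UNIV :: bool set" n] card_lists_length_eq[of "UNIV :: bool set" n]
    by (simp_all add: V_def)
  then have V2: "card V = 2 * 2 ^ (n - 1)" using n(1) by (simp flip: power_Suc)
  \<comment> \<open>Cutting \<open>S\<close> off below length \<open>n\<close> leaves
    \<open>X\<close> as the whole of the oracle at that length.\<close>
  let ?S = "{w \<in> S. length w < n}" and ?x = "replicate n False"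
  obtain E P where E: "E \<subseteq> Pow V" "2 ^ l * card E \<le> 2 ^ (poly q n) * 2 ^ card V"
    and P: "\<forall>y. length y \<le> n \<longrightarrow> P y \<in> deg V D \<and> (\<forall>X\<in>Pow V - E. P y X = of_bool (y \<in> F (?S \<union> X)))"
    using assms[unfolded approximable_def, rule_format, OF V(1), of l n ?S] unfolding D_def by (elim exE conjE)
  have "2 ^ poly q n * (8 * card E) \<le> 2 ^ poly q n * 2 ^ card V"
    using E(2) by (simp add: l_def power_add mult_ac)
  then have "8 * card E \<le> 2 ^ card V" by simp
  moreover have "8 * (D + 1)\<^sup>2 \<le> 2 * 2 ^ (n - 1)" using D V V2 by simp
  moreover have "P ?x \<in> deg V D" using P by simp
  ultimately obtain X where X: "X \<in> Pow V - E" "P ?x X \<noteq> of_bool (odd (card X))"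
    using parity_not_approximable[OF V(1) V2 _ _ E(1), of D "P ?x"] by blast
  have "{w \<in> ?S \<union> X. length w = length ?x} = X" using X(1) by (auto simp: V_def)
  moreover have "P ?x X = of_bool (?x \<in> F (?S \<union> X))" using P X(1) by simp
  then have "(?x \<in> F (?S \<union> X)) \<noteq> odd (card X)"
    using X(2) by (cases "odd (card X)"; cases "?x \<in> F (?S \<union> X)") simp_all
  ultimately have "(?x \<in> F (?S \<union> X)) \<noteq> odd (card {w \<in> ?S \<union> X. length w = length ?x})" by simp
  moreover have "w \<in> ?S \<union> X \<longleftrightarrow> w \<in> S" if "length w < N" for w
    using that n(1) X(1) by (auto simp: V_def)
  ultimately show ?thesis by blast
qed

lemma forceable_parity:
  assumes cs: "\<forall>(M, p)\<in>set cs. wf_otm M"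
  shows "forceable (\<lambda>A. {x. odd (card {w \<in> oracle_of A. length w = length x})} \<noteq> hierarchy cs (oracle_of A))"
  unfolding forceable_def
proof (intro allI)
  fix A :: "nat \<Rightarrow> bool" and N
  obtain k d q where approx: "approximable (hierarchy cs) k d q"
    using approximable_hierarchy[OF cs] by (elim exE)
  obtain B x where B: "\<forall>w. length w < N \<longrightarrow> (w \<in> B \<longleftrightarrow> w \<in> oracle_of A)"
    and x: "(x \<in> hierarchy cs B) \<noteq> odd (card {w \<in> B. length w = length x})"
    using exists_parity_violation[OF approx, of N "oracle_of A"] by (elim exE conjE)
  obtain A' where A': "oracle_of A' = B" using oracle_of_surj by blast
  obtain r where r: "local_op (hierarchy cs) r" using local_hierarchy[OF cs] by (elim exE)
  \<comment> \<open>\<open>N'\<close> covers the strings on which the hierarchy depends at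
    \<open>x\<close> and those whose parity is taken.\<close>
  obtain N' where N': "\<And>w. length w \<le> poly r (length x) + length x \<Longrightarrow> string_index w < N'"
    using string_index_bound by blast
  have "{x. odd (card {w \<in> oracle_of A''. length w = length x})} \<noteq> hierarchy cs (oracle_of A'')"
    if "\<forall>i<N'. A'' i = A' i" for A''
  proof -
    have agree: "w \<in> oracle_of A'' \<longleftrightarrow> w \<in> B" if "length w \<le> poly r (length x) + length x" for w
      using N'[OF that] \<open>\<forall>i<N'. A'' i = A' i\<close> A' by (auto simp: oracle_of_def)
    have "{w \<in> oracle_of A''. length w = length x} = {w \<in> B. length w = length x}"
      using agree by auto
    moreover have "x \<in> hierarchy cs (oracle_of A'') \<longleftrightarrow> x \<in> hierarchy cs B"
      by (rule local_opD[OF r]) (simp add: agree)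
    ultimately have "(x \<in> hierarchy cs (oracle_of A'')) \<noteq>
        (x \<in> {x. odd (card {w \<in> oracle_of A''. length w = length x})})" using x by simp
    then show ?thesis by blast
  qed
  moreover have "\<forall>i<N. A' i = A i" using oracle_of_agree[of N A' A] A' B by blast
  ultimately show "\<exists>A' N'. (\<forall>i<N. A' i = A i) \<and> (\<forall>A''. (\<forall>i<N'. A'' i = A' i) \<longrightarrow>
    {x. odd (card {w \<in> oracle_of A''. length w = length x})} \<noteq> hierarchy cs (oracle_of A''))" by blast
qed

theorem theorem2p13:
  shows "\<not> fsigma {A :: nat \<Rightarrow> bool. PH (oracle_of A) \<noteq> PSPACE (oracle_of A)}"
proof
  let ?S = "{A :: nat \<Rightarrow> bool. PH (oracle_of A) \<noteq> PSPACE (oracle_of A)}"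
  let ?parity = "\<lambda>A. {x. odd (card {w \<in> oracle_of A. length w = length x})}"
  assume "fsigma ?S"
  then show False
  proof cases
    case (1 F)
    let ?R1 = "range (\<lambda>n A. A \<notin> F n)"
    let ?R2 = "(\<lambda>cs A. ?parity A \<noteq> hierarchy cs (oracle_of A)) ` {cs. \<forall>(M, p)\<in>set cs. wf_otm M}"
    have "countable (?R1 \<union> ?R2)"
      by (intro countable_Un countable_image countable_subset[OF subset_UNIV countable_hierarchies]) simp
    moreover have "forceable R" if mem: "R \<in> ?R1 \<union> ?R2" for R
    proof (cases "R \<in> ?R1")
      case True
      then obtain n where R: "R = (\<lambda>A. A \<notin> F n)" by blast
      have "PH (oracle_of A) \<noteq> PSPACE (oracle_of A)" if "A \<in> F n" for A
      proof -
        have "A \<in> ?S" unfolding 1(1) using that by blast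
        then show ?thesis by simp
      qed
      then show ?thesis unfolding R by (rule forceable_avoid[OF 1(2)])
    next
      case False
      then obtain cs where "\<forall>(M, p)\<in>set cs. wf_otm M"
        and R: "R = (\<lambda>A. ?parity A \<noteq> hierarchy cs (oracle_of A))" using mem by blast
      then show ?thesis unfolding R by (intro forceable_parity)
    qed
    ultimately obtain A where A: "\<forall>R\<in>?R1 \<union> ?R2. R A"
      using forceable_generic_countable[of "?R1 \<union> ?R2"] by blast
    then have "A \<notin> F n" for n by (simp add: ball_Un)
    \<comment> \<open>Outside the set the classes coincide, so the parity language would lie in
      \<open>PH\<close>, which the second family of requirements excludes.\<close>
    then have "A \<notin> ?S" unfolding 1(1) by blast
    then have "?parity A \<in> PH (oracle_of A)" using parity_in_PSPACE by simp
    then obtain cs where cs: "\<forall>(M, p)\<in>set cs. wf_otm M" "?parity A = hierarchy cs (oracle_of A)"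
      using PH_hierarchy by blast
    have "\<forall>cs\<in>{cs. \<forall>(M, p)\<in>set cs. wf_otm M}. ?parity A \<noteq> hierarchy cs (oracle_of A)"
      using A by (simp add: ball_Un)
    then have "?parity A \<noteq> hierarchy cs (oracle_of A)" using cs(1) by blast
    then show False using cs(2) by (rule notE)
  qed
qed

end
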